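(* Let $\Gamma=(G,\sigma)$ be a signed graph with $G=(V,E)$, $n=|V|$, let $c$ be the number of connected components of $G$, let $p>1$, and let $\lambda_1\le\dots\le\lambda_n$ be the variational eigenvalues of $\Delta_p^\sigma$. Suppose $k,r\ge1$ are integers with $$\lambda_1\le\dots\le\lambda_{k-1}<\lambda_k=\lambda_{k+1}=\dots=\lambda_{k+r-1}<\lambda_{k+r}\le\dots\le\lambda_n$$ (the first strict inequality being void if $k=1$ and the second if $k+r-1=n$). If $f$ is an eigenfunction of $\Delta_p^\sigma$ corresponding to the eigenvalue $\lambda=\lambda_k$, then $$\mathfrak W(f)\le k+c-1\quad\text{and}\quad \overline{\mathfrak W}(f)\le n-k-r+c+1.$$
   Context: Setting. $G=(V,E)$ is a finite simple undirected graph, $n=|V|$, with edge measure $w:E\to(0,\infty)$, vertex weight $\mu:V\to(0,\infty)$, potential $\kappa:V\to\mathbb R$ and signature $\sigma:E\to\{-1,1\}$; $\Gamma=(G,\sigma)$ is a signed graph. Values are written $w_{xy},\sigma_{xy},\mu_x,\kappa_x$, and $x\sim y$ means $\{x,y\}\in E$. Put $\Phi_p(t)=|t|^{p-2}t$ for $t\neq0$ and $\Phi_p(0)=0$. For $p>1$, $\Delta_p^\sigma f(x)=\sum_{y\sim x}w_{xy}\Phi_p(f(x)-\sigma_{xy}f(y))+\kappa_x\Phi_p(f(x))$, and a nonzero $f:V\to\mathbb R$ is an eigenfunction with eigenvalue $\lambda\in\mathbb R$ if $\Delta_p^\sigma f(x)=\lambda\mu_x\Phi_p(f(x))$ for all $x\in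 V$. Variational eigenvalues. $\mathcal S_p=\{f\in\mathbb R^V:\sum_x\mu_x|f(x)|^p=1\}$. For a compact set $S=-S$ its index (Krasnoselskii genus) $\gamma(S)$ is $0$ if $S=\emptyset$, otherwise the least positive integer $k$ for which an odd continuous map $S\to\mathbb R^k\setminus\{0\}$ exists ($\infty$ if none). $\mathcal F_k(\mathcal S_p)$ is the family of compact $A=-A\subset\mathcal S_p$ with $\gamma(A)\ge k$. With $\mathcal R_p^\sigma(f)=\frac{\sum_{\{x,y\}\in E}w_{xy}|f(x)-\sigma_{xy}f(y)|^p+\sum_{x\in V}\kappa_x|f(x)|^p}{\sum_{x\in V}\mu_x|f(x)|^p}$, set $\lambda_k=\inf_{S\in\mathcal F_k(\mathcal S_p)}\sup_{f\in S}\mathcal R_p^\sigma(f)$, $k=1,\dots,n$. Weak nodal domains. For a signature $s$ on $G$ and $f:V\to\mathbb R$, a walk $x_1,\dots,x_m$ ($m\ge2$, $x_i\sim x_{i+1}$) is a weak nodal domain walk of $f$ with respect to $(G,s)$ if for all $i<j$ with $f(x_i)\ne0$, $f(x_j)\neq0$ and $f(x_\ell)=0$ for $i<\ell<j$ one has $f(x_i)s_{x_ix_{i+1}}\cdots s_{x_{j-1}x_j}f(x_j)>0$. On $\Omega=\{x:f(x)\ne0\}$ let $x,y$ be equivalent if $x=y$ or a weak nodal domain walk connects them; the number of weak nodal domains of $f$ with respect to $(G,s)$ is the number of equivalence classes. It is denoted $\mathfrak W(f)$ for $s=\sigma$ and $\overline{\mathfrak W}(f)$ for $s=-\sigma$.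 *)

theory Defs
  imports "HOL-Analysis.Analysis"
begin

text \<open>
  The vertex set is the whole finite type \<open>'v\<close> and the edges are two-element subsets of it.
  Functions on vertices are vectors in \<open>real ^ 'v\<close>, which supplies the topology used below.
  Edge data is only meaningful on members of \<open>E\<close>.
\<close>

definition simple_edges :: "'v::finite set set \<Rightarrow> bool" where
  "simple_edges E \<longleftrightarrow> (\<forall>e\<in>E. card e = 2)"

definition num_components :: "'v::finite set set \<Rightarrow> nat" where
  "num_components E = card (UNIV // {(x, y). {x, y} \<in> E}\<^sup>*)"

definition Phi :: "real \<Rightarrow> real \<Rightarrow> real" where
  "Phi p t = (if t = 0 then 0 else \<bar>t\<bar> powr (p - 2) * t)"

definition p_laplacian ::
  "'v::finite set set \<Rightarrow> ('v set \<Rightarrow> real) \<Rightarrow> ('v \<Rightarrow> real) \<Rightarrow> ('v set \<Rightarrow> real) \<Rightarrow> real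
    \<Rightarrow> real ^ 'v \<Rightarrow> 'v \<Rightarrow> real" where
  "p_laplacian E w \<kappa> \<sigma> p f x =
     (\<Sum>y | {x, y} \<in> E. w {x, y} * Phi p (f $ x - \<sigma> {x, y} * f $ y)) + \<kappa> x * Phi p (f $ x)"

definition eigenfunction ::
  "'v::finite set set \<Rightarrow> ('v set \<Rightarrow> real) \<Rightarrow> ('v \<Rightarrow> real) \<Rightarrow> ('v \<Rightarrow> real) \<Rightarrow> ('v set \<Rightarrow> real)
    \<Rightarrow> real \<Rightarrow> real \<Rightarrow> real ^ 'v \<Rightarrow> bool" where
  "eigenfunction E w \<mu> \<kappa> \<sigma> p l f \<longleftrightarrow>
     f \<noteq> 0 \<and> (\<forall>x. p_laplacian E w \<kappa> \<sigma> p f x = l * \<mu> x * Phi p (f $ x))"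

text \<open>
  In the Rayleigh quotient, the sum over unordered edges is half the sum over ordered pairs;
  for \<open>\<sigma>\<close> with values \<open>\<plusminus>1\<close> the summand is symmetric in \<open>x\<close> and \<open>y\<close>, so the lemma
  \<open>half_sum_ordered_pairs\<close> applies.
\<close>

lemma half_sum_ordered_pairs:
  fixes E :: "'v::finite set set" and g :: "'v \<Rightarrow> 'v \<Rightarrow> real" and h :: "'v set \<Rightarrow> real"
  assumes E: "simple_edges E" and gh: "\<And>x y. {x, y} \<in> E \<Longrightarrow> g x y = h {x, y}"
  shows "(\<Sum>x\<in>UNIV. \<Sum>y | {x, y} \<in> E. g x y) / 2 = (\<Sum>e\<in>E. h e)"
proof -
  let ?P = "SIGMA x:UNIV. {y. {x, y} \<in> E}"
  let ?Q = "\<lambda>e. {z \<in> ?P. {fst z, snd z} = e}"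
  have "(\<Sum>x\<in>UNIV. \<Sum>y | {x, y} \<in> E. g x y) = (\<Sum>z\<in>?P. g (fst z) (snd z))"
    by (simp add: sum.Sigma case_prod_beta)
  also have "\<dots> = (\<Sum>z\<in>?P. h {fst z, snd z})"
    by (intro sum.cong) (auto simp: gh)
  also have "\<dots> = (\<Sum>e\<in>E. \<Sum>z\<in>?Q e. h {fst z, snd z})"
    by (rule sum.group[symmetric]) auto
  also have "\<dots> = (\<Sum>e\<in>E. 2 * h e)"
  proof (rule sum.cong[OF refl])
    fix e assume e: "e \<in> E"
    then obtain a b where ab: "e = {a, b}" "a \<noteq> b"
      using E unfolding simple_edges_def by (meson card_2_iff)
    have "?Q e = {(a, b), (b, a)}"
      using ab e by (auto simp: doubleton_eq_iff insert_commute)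
    then show "(\<Sum>z\<in>?Q e. h {fst z, snd z}) = 2 * h e"
      using ab by (simp add: insert_commute)
  qed
  finally show ?thesis by (simp add: sum_distrib_left[symmetric])
qed

definition rayleigh ::
  "'v::finite set set \<Rightarrow> ('v set \<Rightarrow> real) \<Rightarrow> ('v \<Rightarrow> real) \<Rightarrow> ('v \<Rightarrow> real) \<Rightarrow> ('v set \<Rightarrow> real)
    \<Rightarrow> real \<Rightarrow> real ^ 'v \<Rightarrow> real" where
  "rayleigh E w \<mu> \<kappa> \<sigma> p f =
     ((\<Sum>x\<in>UNIV. \<Sum>y | {x, y} \<in> E. w {x, y} * \<bar>f $ x - \<sigma> {x, y} * f $ y\<bar> powr p) / 2
        + (\<Sum>x\<in>UNIV. \<kappa> x * \<bar>f $ x\<bar> powr p))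
      / (\<Sum>x\<in>UNIV. \<mu> x * \<bar>f $ x\<bar> powr p)"

definition p_sphere :: "('v::finite \<Rightarrow> real) \<Rightarrow> real \<Rightarrow> (real ^ 'v) set" where
  "p_sphere \<mu> p = {f. (\<Sum>x\<in>UNIV. \<mu> x * \<bar>f $ x\<bar> powr p) = 1}"

text \<open>
  \<open>Euclidean_space k\<close> realises $k$-space as the sequences vanishing from index \<open>k\<close> on.
  In \<open>enat\<close> the infimum of the empty set is \<open>\<infinity>\<close>.
\<close>

definition odd_map_into :: "nat \<Rightarrow> 'a::real_normed_vector set \<Rightarrow> ('a \<Rightarrow> nat \<Rightarrow> real) \<Rightarrow> bool" where
  "odd_map_into k S h \<longleftrightarrow>
     continuous_map (top_of_set S) (Euclidean_space k) h \<and>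
     (\<forall>x\<in>S. h x \<noteq> (\<lambda>i. 0)) \<and> (\<forall>x\<in>S. \<forall>i. h (- x) i = - h x i)"

definition genus :: "'a::real_normed_vector set \<Rightarrow> enat" where
  "genus S = (if S = {} then 0 else Inf {enat k | k. k \<ge> 1 \<and> (\<exists>h. odd_map_into k S h)})"

definition genus_family :: "nat \<Rightarrow> 'a::real_normed_vector set \<Rightarrow> 'a set set" where
  "genus_family k X = {A. compact A \<and> uminus ` A = A \<and> A \<subseteq> X \<and> enat k \<le> genus A}"

text \<open>
  For \<open>1 \<le> k \<le> CARD('v)\<close>, \<open>p > 1\<close> and positive \<open>\<mu>\<close>, the infimum and the suprema below are taken
  over nonempty bounded sets of reals; outside this range the value carries no meaning.
\<close>

definition variational_eigenvalue ::
  "'v::finite set set \<Rightarrow> ('v set \<Rightarrow> real) \<Rightarrow> ('v \<Rightarrow> real) \<Rightarrow> ('v \<Rightarrow> real) \<Rightarrow> ('v set \<Rightarrow> real)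
    \<Rightarrow> real \<Rightarrow> nat \<Rightarrow> real" where
  "variational_eigenvalue E w \<mu> \<kappa> \<sigma> p k =
     (INF S\<in>genus_family k (p_sphere \<mu> p). SUP f\<in>S. rayleigh E w \<mu> \<kappa> \<sigma> p f)"

definition weak_nodal_walk ::
  "'v::finite set set \<Rightarrow> ('v set \<Rightarrow> real) \<Rightarrow> real ^ 'v \<Rightarrow> 'v list \<Rightarrow> bool" where
  "weak_nodal_walk E s f xs \<longleftrightarrow>
     length xs \<ge> 2 \<and> (\<forall>i. Suc i < length xs \<longrightarrow> {xs ! i, xs ! Suc i} \<in> E) \<and>
     (\<forall>i j. i < j \<and> j < length xs \<and> f $ (xs ! i) \<noteq> 0 \<and> f $ (xs ! j) \<noteq> 0 \<and>
            (\<forall>l. i < l \<and> l < j \<longrightarrow> f $ (xs ! l) = 0)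
        \<longrightarrow> f $ (xs ! i) * (\<Prod>l = i..<j. s {xs ! l, xs ! Suc l}) * f $ (xs ! j) > 0)"

definition weak_nodal_rel ::
  "'v::finite set set \<Rightarrow> ('v set \<Rightarrow> real) \<Rightarrow> real ^ 'v \<Rightarrow> ('v \<times> 'v) set" where
  "weak_nodal_rel E s f =
     {(x, y). f $ x \<noteq> 0 \<and> f $ y \<noteq> 0 \<and>
        (x = y \<or> (\<exists>xs. weak_nodal_walk E s f xs \<and> hd xs = x \<and> last xs = y))}"

definition num_weak_nodal_domains ::
  "'v::finite set set \<Rightarrow> ('v set \<Rightarrow> real) \<Rightarrow> real ^ 'v \<Rightarrow> nat" where
  "num_weak_nodal_domains E s f = card ({x. f $ x \<noteq> 0} // weak_nodal_rel E s f)"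

end

theory Submission
  imports Defs "HOL-Homology.Invariance_of_Domain"
begin

text \<open>
  Let $f$ be an eigenfunction with eigenvalue $l = \<lambda>_k$. The \<^emph>\<open>energy\<close> at level $l$ is the numerator
  of the Rayleigh quotient minus $l$ times its denominator, so the energy is negative, zero or
  positive according to whether the Rayleigh quotient is below, at or above $l$; up to the factor
  $p$, the derivative of the energy is the vector \<open>grad l\<close> whose zeros other than $0$ are the
  eigenfunctions.

  \<^emph>\<open>A test space.\<close> The functions $a f$ with $a$ constant on every weak nodal domain form a linear space
  whose dimension is the number of domains. Testing the eigenvalue equation against $|a|^p f$
  writes the energy of $a f$ as a sum over edges (\<open>energy_multiple\<close>). By strict convexity of
  $|t|^p$, the term of an edge joining two different domains has a definite sign: for the domains of
  $(G,\<sigma>)$ it is $\<le> 0$, for those of $(G,-\<sigma>)$ it is $\<ge> 0$, and it vanishes only if $a$ agrees at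
  both ends (\<open>edge_term_opposite_signs\<close>, \<open>edge_term_same_sign\<close>). All other terms are zero.
  If $a f$ has zero energy and is an eigenfunction too, then $a$ is constant on
  every component of $G$ (\<open>multiplier_constant_on_components\<close>): it does not change along edges between
  nonzero values, and at a zero of $f$ the two eigenvalue equations for $f$ and $a f$ make the
  multipliers on the positive and on the negative side equal. Orthogonality to the restrictions
  of $f$ to the $c$ components therefore leaves a space $X$, of dimension at least the number
  of domains minus $c$, on which the energy has a sign and no nonzero point of zero energy
  is critical (\<open>regular_subspace_of_multiples\<close>).

  \<^emph>\<open>Comparison with the variational eigenvalues.\<close> Let the energy be $\<le> 0$ on $X$ and $\dim X \<ge> k$.
  One gradient step moves the unit sphere of $X$ to a set on which the Rayleigh quotient is strictly below $l$; the
  step is odd, so the new set still has genus at least $k$ and $\<lambda>_k < l$, which is absurd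
  (\<open>eigval_less_if_nonpositive_on_subspace\<close>). Let the energy be $\<ge> 0$ on $X$, and let $X$ have
  codimension less than $K = k + r - 1$. Sets on which the Rayleigh quotient is below
  $l + \<epsilon>$ are moved off $X$ by one gradient step; projecting to the complement of $X$ then bounds
  their genus by the codimension of $X$. So $\<lambda>_K \<ge> l + \<epsilon>$, contrary to $\<lambda>_K = \<lambda>_k$
  (\<open>eigval_greater_if_nonnegative_on_subspace\<close>). These two absurdities are the two bounds.

  The genus of a sphere is bounded below by the Borsuk--Ulam theorem (\<open>Borsuk_Ulam_no_odd_map\<close>),
  which follows from the fact that an odd map of a sphere to itself has odd degree.
\<close>

section \<open>Borsuk--Ulam: odd maps of spheres have odd degree\<close>

definition sphere_normalise :: "nat \<Rightarrow> (nat \<Rightarrow> real) \<Rightarrow> nat \<Rightarrow> real" where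
  "sphere_normalise n x = (\<lambda>i. x i / sqrt (\<Sum>j\<le>n. (x j)\<^sup>2))"

lemma sum_squares_eq_0_iff:
  assumes "\<forall>i\<ge>Suc n. x i = (0::real)"
  shows "(\<Sum>j\<le>n. (x j)\<^sup>2) = 0 \<longleftrightarrow> x = (\<lambda>i. 0)"
proof
  assume "(\<Sum>j\<le>n. (x j)\<^sup>2) = 0"
  then have "\<forall>j\<le>n. x j = 0" by (simp add: sum_nonneg_eq_0_iff)
  with assms show "x = (\<lambda>i. 0)" by (metis not_less_eq_eq)
qed simp

lemma sphere_normalise_id:
  "x \<in> topspace (nsphere n) \<Longrightarrow> sphere_normalise n x = x"
  by (simp add: sphere_normalise_def nsphere)

lemma sphere_normalise_uminus:
  "sphere_normalise n (\<lambda>i. - x i) = (\<lambda>i. - sphere_normalise n x i)"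
  by (simp add: sphere_normalise_def)

lemma continuous_map_Euclidean_iff:
  "continuous_map X (Euclidean_space n) G \<longleftrightarrow>
     (\<forall>i. continuous_map X euclideanreal (\<lambda>x. G x i)) \<and> (\<forall>x\<in>topspace X. \<forall>i\<ge>n. G x i = 0)"
  unfolding Euclidean_space_def continuous_map_in_subtopology continuous_map_componentwise_UNIV
  by auto

lemma continuous_map_sphere_normalise:
  assumes G: "continuous_map X (Euclidean_space (Suc n)) G"
    and nz: "\<And>x. x \<in> topspace X \<Longrightarrow> G x \<noteq> (\<lambda>i. 0)"
  shows "continuous_map X (nsphere n) (\<lambda>x. sphere_normalise n (G x))"
proof -
  have c: "\<And>i. continuous_map X euclideanreal (\<lambda>x. G x i)"
    and z: "\<And>x. x \<in> topspace X \<Longrightarrow> \<forall>i\<ge>Suc n. G x i = 0"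
    using G unfolding continuous_map_Euclidean_iff by auto
  have s: "(\<Sum>j\<le>n. (G x j)\<^sup>2) \<noteq> 0" if "x \<in> topspace X" for x
    using sum_squares_eq_0_iff[OF z[OF that]] nz[OF that] by simp
  have s': "(\<Sum>j\<le>n. (G x j)\<^sup>2) > 0" if "x \<in> topspace X" for x
    using s[OF that] sum_nonneg[of "{..n}" "\<lambda>j. (G x j)\<^sup>2"] by fastforce
  have "continuous_map X euclideanreal (\<lambda>x. sphere_normalise n (G x) i)" for i
    unfolding sphere_normalise_def
    by (intro continuous_intros c) (auto simp: s)
  moreover have "(\<Sum>i\<le>n. (sphere_normalise n (G x) i)\<^sup>2) = 1" if "x \<in> topspace X" for x
    using s'[OF that] unfolding sphere_normalise_def power_divide
    by (simp add: sum_nonneg flip: sum_divide_distrib)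
  moreover have "sphere_normalise n (G x) i = 0" if "x \<in> topspace X" "i > n" for x i
    using z[OF that(1)] that(2) by (auto simp: sphere_normalise_def)
  ultimately show ?thesis
    unfolding nsphere continuous_map_in_subtopology continuous_map_componentwise_UNIV by auto
qed

text \<open>
  A homotopy of maps into Euclidean space is easier to write down than one of maps into the sphere,
  and as long as it avoids the origin it can be normalised.
\<close>

lemma degree_homotopy_nonvanishing:
  assumes c: "\<And>i. continuous_map (prod_topology (top_of_set {0..1::real}) (nsphere n)) euclideanreal
                     (\<lambda>z. G (fst z) (snd z) i)"
    and z: "\<And>t x i. t \<in> {0..1} \<Longrightarrow> x \<in> topspace (nsphere n) \<Longrightarrow> i \<ge> Suc n \<Longrightarrow> G t x i = 0"
    and nz: "\<And>t x. t \<in> {0..1} \<Longrightarrow> x \<in> topspace (nsphere n) \<Longrightarrow> G t x \<noteq> (\<lambda>i. 0)"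
  shows "Brouwer_degree2 n (\<lambda>x. sphere_normalise n (G 0 x))
       = Brouwer_degree2 n (\<lambda>x. sphere_normalise n (G 1 x))"
proof (rule Brouwer_degree2_homotopic)
  have "continuous_map (prod_topology (top_of_set {0..1::real}) (nsphere n)) (nsphere n)
          (\<lambda>z. sphere_normalise n (G (fst z) (snd z)))"
  proof (rule continuous_map_sphere_normalise)
    show "continuous_map (prod_topology (top_of_set {0..1}) (nsphere n)) (Euclidean_space (Suc n))
             (\<lambda>z. G (fst z) (snd z))"
      unfolding continuous_map_Euclidean_iff using c z by auto
    show "\<And>x. x \<in> topspace (prod_topology (top_of_set {0..1}) (nsphere n)) \<Longrightarrow> G (fst x) (snd x) \<noteq> (\<lambda>i. 0)"
      using nz by auto
  qed
  then show "homotopic_with (\<lambda>x. True) (nsphere n) (nsphere n) (\<lambda>x. sphere_normalise n (G 0 x))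
               (\<lambda>x. sphere_normalise n (G 1 x))"
    by (auto simp: homotopic_with intro!: exI[of _ "\<lambda>z. sphere_normalise n (G (fst z) (snd z))"])
qed

text \<open>
  Restricted to the equator, an odd self-map $f$ of $S^n$ may be surjective. Its polynomial approximations
  are not: the cone over the image of an $(n-1)$-sphere under a smooth map is a smooth image of an
  $n$-dimensional space, hence a null set in dimension $n+1$. The vector $P$ found here lies on no line
  through the image of the equator, and $P_n \<noteq> 0$ makes it possible to project along $P$ to the
  hyperplane of the equator. Taking the odd part of the polynomial keeps the symmetry.

  Polynomials and null sets are taken in the Euclidean space \<open>real ^ 'v\<close>, among whose coordinates
  \<open>b\<close> places those numbered $0,\dots,n$; on the remaining coordinates the cone map is the identity.
\<close>

lemma odd_sphere_map_generic_approximation: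
  fixes b :: "nat \<Rightarrow> 'v::finite"
  assumes b: "inj_on b {..n}" and n: "n \<ge> 1"
    and f: "continuous_map (nsphere n) (nsphere n) f"
    and odd: "\<And>x. x \<in> topspace (nsphere n) \<Longrightarrow> f (\<lambda>i. - x i) = (\<lambda>i. - f x i)"
  obtains Q P where
    "continuous_map (nsphere n) (Euclidean_space (Suc n)) Q"
    "\<And>x. x \<in> topspace (nsphere n) \<Longrightarrow> Q (\<lambda>i. - x i) = (\<lambda>i. - Q x i)"
    "\<And>x. x \<in> topspace (nsphere n) \<Longrightarrow> (\<Sum>i\<le>n. (f x i - Q x i)\<^sup>2) < 1"
    "P n \<noteq> (0::real)" "\<And>i. i > n \<Longrightarrow> P i = 0"
    "\<And>x c. x \<in> topspace (nsphere n) \<Longrightarrow> x n = 0 \<Longrightarrow> Q x = (\<lambda>i. c * P i) \<Longrightarrow> Q x = (\<lambda>i. 0)"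
proof -
  define emb :: "(nat \<Rightarrow> real) \<Rightarrow> real ^ 'v" where "emb x = (\<Sum>i\<le>n. x i *\<^sub>R axis (b i) 1)" for x
  define pr :: "real ^ 'v \<Rightarrow> nat \<Rightarrow> real" where "pr y = (\<lambda>i. if i \<le> n then y $ b i else 0)" for y
  have emb_b: "emb x $ b i = x i" if "i \<le> n" for x i
  proof -
    have "emb x $ b i = (\<Sum>j\<le>n. if j = i then x j else 0)"
      unfolding emb_def sum_component using b that
      by (intro sum.cong) (auto simp: axis_def inj_on_def)
    then show ?thesis using that by simp
  qed
  have emb_out: "emb x $ v = 0" if "v \<notin> b ` {..n}" for x v
    unfolding emb_def sum_component using that by (auto simp: axis_def intro!: sum.neutral)
  have emb_minus: "emb (\<lambda>i. - x i) = - emb x" for x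
    by (simp add: emb_def sum_negf)
  have emb_scale: "emb (\<lambda>i. c * x i) = c *\<^sub>R emb x" for x c
    by (simp add: emb_def scaleR_sum_right)
  have pr_emb: "pr (emb x) = x" if "\<forall>i>n. x i = 0" for x
    using that by (auto simp: pr_def emb_b)
  have sumb: "(\<Sum>v\<in>UNIV. g v) = (\<Sum>i\<le>n. g (b i))" if "\<And>v. v \<notin> b ` {..n} \<Longrightarrow> g v = 0" for g :: "'v \<Rightarrow> real"
  proof -
    have "(\<Sum>v\<in>UNIV. g v) = (\<Sum>v\<in>b ` {..n}. g v)"
      by (intro sum.mono_neutral_right) (auto simp: that)
    then show ?thesis using b by (simp add: sum.reindex)
  qed
  have norm_emb: "(norm (emb x))\<^sup>2 = (\<Sum>i\<le>n. (x i)\<^sup>2)" for x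
  proof -
    have "(norm (emb x))\<^sup>2 = (\<Sum>v\<in>UNIV. (emb x $ v)\<^sup>2)"
      by (simp add: norm_vec_def L2_set_def sum_nonneg)
    also have "\<dots> = (\<Sum>i\<le>n. (emb x $ b i)\<^sup>2)" by (rule sumb) (simp add: emb_out)
    finally show ?thesis by (simp add: emb_b)
  qed
  let ?S = "topspace (nsphere n)"
  define K where "K = emb ` ?S"
  have S_iff: "x \<in> ?S \<longleftrightarrow> (\<Sum>i\<le>n. (x i)\<^sup>2) = 1 \<and> (\<forall>i>n. x i = 0)" for x
    by (simp add: nsphere)
  have S_minus: "(\<lambda>i. - x i) \<in> ?S" if "x \<in> ?S" for x using that by (simp add: S_iff)
  have K_iff: "y \<in> K \<longleftrightarrow> norm y = 1 \<and> (\<forall>v. v \<notin> b ` {..n} \<longrightarrow> y $ v = 0)" for y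
  proof
    assume "y \<in> K"
    then obtain x where x: "x \<in> ?S" "y = emb x" by (auto simp: K_def)
    then have "(norm y)\<^sup>2 = 1" by (simp add: norm_emb S_iff)
    then show "norm y = 1 \<and> (\<forall>v. v \<notin> b ` {..n} \<longrightarrow> y $ v = 0)"
      using x emb_out by (simp add: power2_eq_1_iff) (metis abs_norm_cancel abs_neg_one)
  next
    assume y: "norm y = 1 \<and> (\<forall>v. v \<notin> b ` {..n} \<longrightarrow> y $ v = 0)"
    have e: "emb (pr y) = y"
    proof (subst vec_eq_iff, rule allI)
      fix v show "emb (pr y) $ v = y $ v"
      proof (cases "v \<in> b ` {..n}")
        case True then obtain i where "i \<le> n" "v = b i" by auto
        then show ?thesis by (simp add: emb_b) (simp add: pr_def)
      next
        case False then show ?thesis using y emb_out by simp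
      qed
    qed
    have "(\<Sum>i\<le>n. (pr y i)\<^sup>2) = 1" using norm_emb[of "pr y"] y e by simp
    then have "pr y \<in> ?S" by (simp add: S_iff) (simp add: pr_def)
    then show "y \<in> K" unfolding K_def using e by (metis imageI)
  qed
  have "K = sphere 0 1 \<inter> {y. \<forall>v. v \<notin> b ` {..n} \<longrightarrow> y $ v = 0}"
    by (auto simp: K_iff)
  moreover have "closed {y :: real^'v. \<forall>v. v \<notin> b ` {..n} \<longrightarrow> y $ v = 0}"
    by (intro closed_Collect_all closed_Collect_imp closed_Collect_eq open_Collect_const continuous_intros)
  ultimately have "compact K" by (simp add: compact_Int_closed)
  have prK: "continuous_map (top_of_set K) (nsphere n) pr"
    unfolding nsphere continuous_map_in_subtopology continuous_map_componentwise_UNIV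
  proof (intro conjI allI)
    show "continuous_map (top_of_set K) euclideanreal (\<lambda>x. pr x k)" for k
      by (cases "k \<le> n") (auto simp: pr_def continuous_map_iff_continuous intro!: continuous_intros)
    show "pr \<in> topspace (top_of_set K) \<rightarrow> {x. (\<Sum>i\<le>n. (x i)\<^sup>2) = 1 \<and> (\<forall>i>n. x i = 0)}"
      using S_iff pr_emb by (auto simp: K_def)
  qed
  have embc: "continuous_map (nsphere n) euclidean (\<lambda>x. emb x)"
  proof -
    have "continuous_map (nsphere n) euclidean (\<lambda>x. x i *\<^sub>R (axis (b i) 1 :: real^'v))" for i
      using continuous_map_compose[OF continuous_map_nsphere_projection[of n i],
          of euclidean "\<lambda>t. t *\<^sub>R (axis (b i) 1 :: real^'v)"]
      by (simp add: o_def continuous_intros)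
    then show ?thesis unfolding emb_def by (intro continuous_intros) auto
  qed
  have "continuous_map (top_of_set K) euclidean (emb \<circ> f \<circ> pr)"
    by (intro continuous_map_compose[OF prK] continuous_map_compose[OF f] embc)
  then have "continuous_on K (emb \<circ> f \<circ> pr)" by (simp add: continuous_map_iff_continuous)
  then obtain q where q: "polynomial_function q" "\<And>x. x \<in> K \<Longrightarrow> norm ((emb \<circ> f \<circ> pr) x - q x) < 1"
    using Stone_Weierstrass_polynomial_function[OF \<open>compact K\<close>, of "emb \<circ> f \<circ> pr" 1] by auto
  define q' where "q' y = (1/2) *\<^sub>R (q y - q (- y))" for y
  have q'minus: "q' (- y) = - q' y" for y by (simp add: q'_def flip: scaleR_minus_right)
  have pm: "polynomial_function (\<lambda>y. q (- y))"
    using polynomial_function_compose[OF _ q(1), of uminus] polynomial_function_minus[OF polynomial_function_id]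
    by (simp add: o_def)
  have q'poly: "polynomial_function q'"
    unfolding q'_def using q(1) pm
    by (intro polynomial_function_mult polynomial_function_diff) auto
  have q'approx: "norm ((emb \<circ> f \<circ> pr) (emb x) - q' (emb x)) < 1" if x: "x \<in> ?S" for x
  proof -
    let ?g = "emb \<circ> f \<circ> pr"
    have gx: "?g (emb x) = emb (f x)" and gmx: "?g (- emb x) = - emb (f x)"
      using x S_minus[OF x] pr_emb[of x] pr_emb[of "\<lambda>i. - x i"] odd[OF x]
      by (simp_all add: S_iff emb_minus flip: emb_minus)
    have k: "emb x \<in> K" "- emb x \<in> K"
      using x S_minus[OF x] by (auto simp: K_def simp flip: emb_minus)
    have "?g (emb x) - q' (emb x) = (1/2) *\<^sub>R ((?g (emb x) - q (emb x)) - (?g (- emb x) - q (- emb x)))"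
    proof -
      have "emb (f x) = (1/2) *\<^sub>R (emb (f x) + emb (f x))"
        by (simp flip: scaleR_2)
      then show ?thesis unfolding q'_def gx gmx by (simp add: algebra_simps)
    qed
    moreover have "norm ((1/2) *\<^sub>R (u - v)) \<le> (norm u + norm v) / 2" for u v :: "real^'v"
      using norm_triangle_ineq4[of u v] by simp
    ultimately have "norm (?g (emb x) - q' (emb x)) \<le> (norm (?g (emb x) - q (emb x)) + norm (?g (- emb x) - q (- emb x))) / 2"
      by metis
    moreover have "u < 1" if "u \<le> (v + w) / 2" "v < 1" "w < 1" for u v w :: real
      using that by simp
    ultimately show ?thesis using q(2)[OF k(1)] q(2)[OF k(2)] by blast
  qed
  define Q where "Q x = pr (q' (emb x))" for x
  define pn where "pn y = emb (pr y)" for y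
  define z where "z y = (\<Sum>i<n. (y $ b i) *\<^sub>R axis (b i) (1::real))" for y :: "real^'v"
  \<comment> \<open>The cone map $y \mapsto |y|\,q'(y/|y|)$ on the first $n$ coordinates, with the identity on the coordinates beyond the first $n+1$; it is smooth on the hyperplane \<open>D\<close>, a null set.\<close>
  define T where "T y = norm (z y) *\<^sub>R pn (q' ((1 / norm (z y)) *\<^sub>R z y)) + (y - pn y)" for y
  define D where "D = {y. y $ b n = 0 \<and> z y \<noteq> 0}"
  have q'diff: "q' differentiable (at y)" for y
    using differentiable_on_polynomial_function[OF q'poly, of UNIV] by (simp add: differentiable_on_def)
  have linpn: "linear pn"
    unfolding pn_def emb_def pr_def
    by (intro linearI) (auto simp: scaleR_sum_right sum.distrib algebra_simps)
  have linz: "linear z"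
    unfolding z_def by (intro linearI) (auto simp: scaleR_sum_right sum.distrib algebra_simps)
  have "T differentiable_on D"
    unfolding differentiable_on_def
  proof
    fix y assume "y \<in> D"
    then have zy: "z y \<noteq> 0" by (simp add: D_def)
    have dz: "z differentiable (at y)" and dpn: "\<And>u. pn differentiable (at u)"
      using linz linpn linear_imp_differentiable by auto
    have dn: "(\<lambda>y. norm (z y)) differentiable (at y)"
      using differentiable_chain_at[OF dz differentiable_norm_at[OF zy]] by (simp add: o_def)
    have dd: "(\<lambda>y. (1 / norm (z y)) *\<^sub>R z y) differentiable (at y)"
      using zy by (intro derivative_intros dn dz) auto
    have "(\<lambda>y. pn (q' ((1 / norm (z y)) *\<^sub>R z y))) differentiable (at y)"
      using differentiable_chain_at[OF dd differentiable_chain_at[OF q'diff dpn]] by (simp add: o_def)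
    then have "T differentiable (at y)"
      unfolding T_def by (intro derivative_intros dn dpn) auto
    then show "T differentiable (at y within D)" by (rule differentiable_at_withinI)
  qed
  moreover have hyp: "negligible {y :: real^'v. y $ b n = 0}"
    using negligible_standard_hyperplane_cart by auto
  then have "negligible D" unfolding D_def by (rule negligible_subset) auto
  ultimately have "negligible (T ` D)"
    by (intro negligible_differentiable_image_negligible) auto
  then have "negligible (T ` D \<union> {y. y $ b n = 0})" using hyp by simp
  then obtain P0 where P0: "P0 \<notin> T ` D" "P0 $ b n \<noteq> 0"
    by (metis (mono_tags, lifting) UNIV_eq_I UnI1 UnI2 mem_Collect_eq non_negligible_UNIV)
  have notpos: False
    if x: "x \<in> ?S" "x n = 0" and eq: "Q x = (\<lambda>i. c * pr P0 i)" and c: "c > 0" for x c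
  proof -
    \<comment> \<open>A multiple of $P$ in the image of the equator would make \<open>P0\<close> itself a value of the cone map.\<close>
    define y where "y = (1/c) *\<^sub>R emb x + (P0 - pn P0)"
    have pnb: "pn u $ b i = u $ b i" if "i \<le> n" for u i
      using that by (simp add: pn_def emb_b) (simp add: pr_def)
    have yb: "y $ b i = (1/c) * x i" if "i \<le> n" for i
      using that by (simp add: y_def emb_b pnb)
    have "emb x = (\<Sum>i<n. x i *\<^sub>R axis (b i) 1)"
      using x(2) by (simp add: emb_def flip: lessThan_Suc_atMost)
    then have zy: "z y = (1/c) *\<^sub>R emb x"
      unfolding z_def by (simp add: yb scaleR_sum_right)
    have nx: "norm (emb x) = 1" using x(1) K_iff by (auto simp: K_def)
    then have nz: "norm (z y) = 1/c" using c by (simp add: zy)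
    then have yD: "y \<in> D" unfolding D_def using yb[of n] x(2) c by auto
    have "pn y = (1/c) *\<^sub>R emb x"
    proof (subst vec_eq_iff, rule allI)
      fix v show "pn y $ v = ((1/c) *\<^sub>R emb x) $ v"
      proof (cases "v \<in> b ` {..n}")
        case True then obtain i where "i \<le> n" "v = b i" by auto
        then show ?thesis using yb by (simp add: pnb emb_b)
      next
        case False then show ?thesis by (simp add: pn_def emb_out)
      qed
    qed
    moreover have "(1 / norm (z y)) *\<^sub>R z y = emb x" using c by (simp add: nz) (simp add: zy)
    moreover have "pn (q' (emb x)) = c *\<^sub>R pn P0"
      using eq by (simp add: Q_def pn_def emb_scale)
    ultimately have "T y = P0"
      unfolding T_def nz using c by (simp add: y_def)
    with yD P0(1) show False by blast
  qed
  show thesis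
  proof (rule that)
    show "continuous_map (nsphere n) (Euclidean_space (Suc n)) Q"
      unfolding continuous_map_Euclidean_iff
    proof (intro conjI allI ballI impI)
      fix i
      have "continuous_on UNIV q'" using q'poly by (rule continuous_on_polymonial_function)
      then have c: "continuous_map (nsphere n) euclidean (q' \<circ> emb)"
        by (intro continuous_map_compose[OF embc]) simp
      have "continuous_map euclidean euclideanreal (\<lambda>u::real^'v. u $ b i)"
        by (auto intro!: continuous_intros)
      from continuous_map_compose[OF c this]
      show "continuous_map (nsphere n) euclideanreal (\<lambda>x. Q x i)"
        by (cases "i \<le> n") (simp_all add: Q_def pr_def o_def)
    qed (simp add: Q_def pr_def)
    show "Q (\<lambda>i. - x i) = (\<lambda>i. - Q x i)" for x
      by (simp add: Q_def emb_minus q'minus) (auto simp: pr_def)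
    show "(\<Sum>i\<le>n. (f x i - Q x i)\<^sup>2) < 1" if x: "x \<in> ?S" for x
    proof -
      let ?u = "emb (f x) - q' (emb x)"
      have "norm ?u < 1" using q'approx[OF x] x pr_emb[of x] by (simp add: S_iff)
      then have "(norm ?u)\<^sup>2 < 1" by (simp add: power_less_one_iff abs_square_less_1)
      moreover have "(\<Sum>i\<le>n. (?u $ b i)\<^sup>2) = (\<Sum>v\<in>b ` {..n}. (?u $ v)\<^sup>2)"
        using b by (simp add: sum.reindex)
      moreover have "\<dots> \<le> (\<Sum>v\<in>UNIV. (?u $ v)\<^sup>2)" by (intro sum_mono2) auto
      moreover have "(norm ?u)\<^sup>2 = (\<Sum>v\<in>UNIV. (?u $ v)\<^sup>2)"
        by (simp add: norm_vec_def L2_set_def sum_nonneg)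
      moreover have "(\<Sum>i\<le>n. (?u $ b i)\<^sup>2) = (\<Sum>i\<le>n. (f x i - Q x i)\<^sup>2)"
        by (intro sum.cong) (auto simp: emb_b Q_def pr_def)
      ultimately show ?thesis by linarith
    qed
    show "pr P0 n \<noteq> 0" using P0 by (simp add: pr_def)
    show "\<And>i. i > n \<Longrightarrow> pr P0 i = 0" by (simp add: pr_def)
    show "Q x = (\<lambda>i. 0)" if x: "x \<in> ?S" "x n = 0" "Q x = (\<lambda>i. c * pr P0 i)" for x c
    proof (cases c "0::real" rule: linorder_cases)
      case less
      have "Q (\<lambda>i. - x i) = (\<lambda>i. - Q x i)"
        by (simp add: Q_def emb_minus q'minus) (auto simp: pr_def)
      then have "Q (\<lambda>i. - x i) = (\<lambda>i. (- c) * pr P0 i)"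
        using x(3) by simp
      then have False using notpos[OF S_minus[OF x(1)], of "- c"] x(2) less by simp
      then show ?thesis ..
    next
      case equal then show ?thesis using x by simp
    next
      case greater then show ?thesis using notpos x by blast
    qed
  qed
qed


text \<open>
  Induction on the dimension. The theorem \<open>Borsuk_odd_mapping_degree_step\<close> compares the
  degree of an odd map with the degree of its restriction to the equator, provided that the equator is mapped to
  the equator. To achieve this by an odd homotopy, replace the map by its generic approximation $Q$ and
  subtract from $Q$, with weight $1 - |x_n|$, its component along $P$: on the equator the weight is $1$ and
  the last coordinate disappears, off the equator the weight is less than $1$ and the difference cannot vanish.
\<close>

lemma odd_sphere_map_degree:
  fixes b :: "nat \<Rightarrow> 'v::finite"
  assumes "inj_on b {..n}"
    and "continuous_map (nsphere n) (nsphere n) f"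
    and "\<And>x. x \<in> topspace (nsphere n) \<Longrightarrow> f (\<lambda>i. - x i) = (\<lambda>i. - f x i)"
  shows "odd (Brouwer_degree2 n f)"
  using assms
proof (induction n arbitrary: f)
  case 0
  define e :: "nat \<Rightarrow> real" where "e = (\<lambda>i. if i = 0 then 1 else 0)"
  have S: "topspace (nsphere 0) = {e, \<lambda>i. - e i}"
    by (fastforce simp: nsphere e_def power2_eq_1_iff)
  have ef: "f (\<lambda>i. - e i) = (\<lambda>i. - f e i)" using 0(3) S by auto
  have "f e \<in> topspace (nsphere 0)"
    using 0(2) S by (auto simp: continuous_map_def)
  then consider "f e = e" | "f e = (\<lambda>i. - e i)" using S by auto
  then show ?case
  proof cases
    case 1
    then have "Brouwer_degree2 0 f = Brouwer_degree2 0 id"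
      using S ef by (intro Brouwer_degree2_eq) auto
    then show ?thesis by simp
  next
    case 2
    then have "Brouwer_degree2 0 f = Brouwer_degree2 0 (\<lambda>x i. if i = 0 then - x i else x i)"
      using S ef by (intro Brouwer_degree2_eq) (auto simp: e_def)
    then show ?thesis by (simp add: Brouwer_degree2_reflection)
  qed
next
  case (Suc n)
  let ?m = "Suc n" and ?S = "topspace (nsphere (Suc n))"
  note f = Suc.prems(2) and oddf = Suc.prems(3)
  obtain Q P where Q: "continuous_map (nsphere ?m) (Euclidean_space (Suc ?m)) Q"
    and Qodd: "\<And>x. x \<in> ?S \<Longrightarrow> Q (\<lambda>i. - x i) = (\<lambda>i. - Q x i)"
    and near: "\<And>x. x \<in> ?S \<Longrightarrow> (\<Sum>i\<le>?m. (f x i - Q x i)\<^sup>2) < 1"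
    and Pm: "P ?m \<noteq> 0" and P0: "\<And>i. i > ?m \<Longrightarrow> P i = 0"
    and avoid: "\<And>x c. x \<in> ?S \<Longrightarrow> x ?m = 0 \<Longrightarrow> Q x = (\<lambda>i. c * P i) \<Longrightarrow> Q x = (\<lambda>i. 0)"
    using odd_sphere_map_generic_approximation[OF Suc.prems(1) _ f oddf] by auto
  have S_iff: "x \<in> ?S \<longleftrightarrow> (\<Sum>i\<le>?m. (x i)\<^sup>2) = 1 \<and> (\<forall>i>?m. x i = 0)" for x
    by (simp add: nsphere)
  have Sminus: "(\<lambda>i. - x i) \<in> ?S" if "x \<in> ?S" for x using that by (simp add: S_iff)
  have fS: "f x \<in> ?S" if "x \<in> ?S" for x
    using f that by (auto simp: continuous_map_def)
  have fc: "continuous_map (nsphere ?m) euclideanreal (\<lambda>x. f x i)" for i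
    using f unfolding nsphere[of ?m] continuous_map_in_subtopology continuous_map_componentwise_UNIV
    by auto
  have Qc: "\<And>i. continuous_map (nsphere ?m) euclideanreal (\<lambda>x. Q x i)"
    and Q0: "\<And>x i. x \<in> ?S \<Longrightarrow> i \<ge> Suc ?m \<Longrightarrow> Q x i = 0"
    using Q unfolding continuous_map_Euclidean_iff by auto
  have liftc: "continuous_map (prod_topology (top_of_set {0..1::real}) (nsphere ?m)) euclideanreal (\<lambda>z. u (snd z))"
    if "continuous_map (nsphere ?m) euclideanreal u" for u
    using continuous_map_compose[OF continuous_map_snd that] by (simp add: o_def)
  have paramc: "continuous_map (prod_topology (top_of_set {0..1::real}) (nsphere ?m)) euclideanreal fst"
    using continuous_map_into_fulltopology[OF continuous_map_fst] by blast
  have nz1: "(\<lambda>i. (1 - t) * f x i + t * Q x i) \<noteq> (\<lambda>i. 0)"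
    if t: "t \<in> {0..1}" and x: "x \<in> ?S" for t x
  proof
    assume "(\<lambda>i. (1 - t) * f x i + t * Q x i) = (\<lambda>i. 0)"
    then have "f x i = t * (f x i - Q x i)" for i
      by (simp add: fun_eq_iff algebra_simps)
    then have "(\<Sum>i\<le>?m. (f x i)\<^sup>2) = (\<Sum>i\<le>?m. (t * (f x i - Q x i))\<^sup>2)"
      by metis
    then have "1 = t\<^sup>2 * (\<Sum>i\<le>?m. (f x i - Q x i)\<^sup>2)"
      using fS[OF x] S_iff by (simp only: power_mult_distrib sum_distrib_left)
    moreover have "t\<^sup>2 * (\<Sum>i\<le>?m. (f x i - Q x i)\<^sup>2) \<le> 1 * (\<Sum>i\<le>?m. (f x i - Q x i)\<^sup>2)"
      using t by (intro mult_right_mono sum_nonneg) (auto simp: power_le_one)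
    ultimately show False using near[OF x] by linarith
  qed
  have deg1: "Brouwer_degree2 ?m f = Brouwer_degree2 ?m (\<lambda>x. sphere_normalise ?m (Q x))"
  proof -
    have "Brouwer_degree2 ?m f = Brouwer_degree2 ?m (\<lambda>x. sphere_normalise ?m (\<lambda>i. (1 - 0) * f x i + 0 * Q x i))"
      using fS by (intro Brouwer_degree2_eq) (simp add: sphere_normalise_id)
    also have "\<dots> = Brouwer_degree2 ?m (\<lambda>x. sphere_normalise ?m (\<lambda>i. (1 - 1) * f x i + 1 * Q x i))"
    proof (rule degree_homotopy_nonvanishing[where G = "\<lambda>t x i. (1 - t) * f x i + t * Q x i"])
      show "continuous_map (prod_topology (top_of_set {0..1}) (nsphere ?m)) euclideanreal
              (\<lambda>z. (1 - fst z) * f (snd z) i + fst z * Q (snd z) i)" for i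
        by (intro continuous_intros liftc fc Qc paramc)
      show "(1 - t) * f x i + t * Q x i = 0" if "x \<in> ?S" "i \<ge> Suc ?m" for t x i
      proof -
        have "f x i = 0" using fS[OF that(1)] that(2) by (simp only: S_iff)
        then show ?thesis using Q0[OF that] by simp
      qed
    qed (rule nz1)
    finally show ?thesis by simp
  qed
  have Qnz: "Q x \<noteq> (\<lambda>i. 0)" if x: "x \<in> ?S" for x using nz1[of 1 x] x by auto
  define R where "R t x = (\<lambda>i. Q x i - t * (1 - \<bar>x ?m\<bar>) * (Q x ?m / P ?m) * P i)" for t x
  have Rc: "continuous_map (prod_topology (top_of_set {0..1}) (nsphere ?m)) euclideanreal (\<lambda>z. R (fst z) (snd z) i)" for i
    unfolding R_def by (intro continuous_intros liftc Qc paramc continuous_map_nsphere_projection) (use Pm in auto)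
  have R0: "R t x i = 0" if "x \<in> ?S" "i \<ge> Suc ?m" for t x i
    using that Q0 P0 by (simp add: R_def)
  have Rnz: "R t x \<noteq> (\<lambda>i. 0)" if t: "t \<in> {0..1}" and x: "x \<in> ?S" for t x
  proof
    assume eq: "R t x = (\<lambda>i. 0)"
    let ?c = "t * (1 - \<bar>x ?m\<bar>) * (Q x ?m / P ?m)"
    have coord: "Q x i - ?c * P i = 0" for i using fun_cong[OF eq, of i] unfolding R_def .
    then have QP: "Q x = (\<lambda>i. ?c * P i)" by (intro ext) (metis eq_iff_diff_eq_0)
    have "Q x ?m * (1 - t * (1 - \<bar>x ?m\<bar>)) = 0"
    proof -
      have "?c * P ?m = Q x ?m * (t * (1 - \<bar>x ?m\<bar>))" using Pm by simp
      then show ?thesis using coord[of ?m] by (simp only: right_diff_distrib mult_1_right)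
    qed
    moreover have "Q x ?m \<noteq> 0"
    proof
      assume "Q x ?m = 0"
      then have "R t x = Q x" by (simp add: R_def)
      then show False using eq Qnz[OF x] by simp
    qed
    ultimately have "t * (1 - \<bar>x ?m\<bar>) = 1" by simp
    moreover have "t * (1 - \<bar>x ?m\<bar>) \<le> 1 - \<bar>x ?m\<bar>" if "\<bar>x ?m\<bar> \<le> 1"
      using t that mult_right_mono[of t 1 "1 - \<bar>x ?m\<bar>"] by simp
    moreover have "t * (1 - \<bar>x ?m\<bar>) \<le> 0" if "\<not> \<bar>x ?m\<bar> \<le> 1"
      using t that by (simp add: mult_nonneg_nonpos)
    ultimately have "x ?m = 0" by (cases "\<bar>x ?m\<bar> \<le> 1") auto
    from avoid[OF x this QP] Qnz[OF x] show False by blast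
  qed
  define g where "g x = sphere_normalise ?m (R 1 x)" for x
  have deg2: "Brouwer_degree2 ?m f = Brouwer_degree2 ?m g"
    using degree_homotopy_nonvanishing[of ?m R, OF Rc R0 Rnz] deg1 by (simp add: R_def g_def[abs_def])
  have R1c: "continuous_map (nsphere ?m) (Euclidean_space (Suc ?m)) (R 1)"
    unfolding continuous_map_Euclidean_iff R_def[abs_def]
    by (intro conjI allI continuous_intros Qc continuous_map_nsphere_projection)
       (use Pm Q0 P0 in auto)
  have g: "continuous_map (nsphere ?m) (nsphere ?m) g"
    unfolding g_def[abs_def] by (rule continuous_map_sphere_normalise[OF R1c]) (use Rnz in auto)
  have gS: "g x \<in> ?S" if "x \<in> ?S" for x using g that by (auto simp: continuous_map_def)
  have godd: "g (\<lambda>i. - x i) = (\<lambda>i. - g x i)" if x: "x \<in> ?S" for x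
    unfolding g_def by (simp add: Qodd[OF x] R_def flip: sphere_normalise_uminus)
  have geq: "g x ?m = 0" if "x ?m = 0" for x
    using that Pm by (simp add: g_def R_def sphere_normalise_def)
  have equator: "subtopology (nsphere ?m) {x. x ?m = 0} = nsphere n"
    by (rule subtopology_nsphere_equator)
  have eqS: "x \<in> topspace (nsphere n) \<longleftrightarrow> x \<in> ?S \<and> x ?m = 0" for x
    by (subst equator[symmetric]) auto
  have "continuous_map (nsphere n) (nsphere n) g"
    unfolding equator[symmetric] continuous_map_in_subtopology
    using g geq by (auto intro: continuous_map_from_subtopology)
  then have "odd (Brouwer_degree2 n g)"
    using Suc.prems(1) godd eqS by (intro Suc.IH) (auto simp: inj_on_def)
  moreover have "even (Brouwer_degree2 ?m g - Brouwer_degree2 (?m - Suc 0) g)"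
    by (rule Borsuk_odd_mapping_degree_step[OF g]) (use godd geq gS eqS in auto)
  ultimately show ?case using deg2 by simp
qed

text \<open>
  Normalised, such a map would be an odd self-map of $S^n$ that omits a pole; a map that is not
  surjective has degree zero, which is even.
\<close>

proposition Borsuk_Ulam_no_odd_map:
  fixes b :: "nat \<Rightarrow> 'v::finite"
  assumes b: "inj_on b {..n}" and jn: "j \<le> n"
    and h: "continuous_map (nsphere n) (Euclidean_space j) h"
    and odd: "\<And>x. x \<in> topspace (nsphere n) \<Longrightarrow> h (\<lambda>i. - x i) = (\<lambda>i. - h x i)"
    and nz: "\<And>x. x \<in> topspace (nsphere n) \<Longrightarrow> h x \<noteq> (\<lambda>i. 0)"
  shows False
proof -
  let ?g = "\<lambda>x. sphere_normalise n (h x)"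
  have "continuous_map (nsphere n) (Euclidean_space (Suc n)) h"
    using h jn unfolding continuous_map_Euclidean_iff by auto
  then have g: "continuous_map (nsphere n) (nsphere n) ?g"
    using nz by (rule continuous_map_sphere_normalise)
  define e :: "nat \<Rightarrow> real" where "e = (\<lambda>i. if i = n then 1 else 0)"
  have "(\<Sum>i\<le>n. (e i)\<^sup>2) = (\<Sum>i\<le>n. if i = n then 1 else 0)"
    by (intro sum.cong) (auto simp: e_def)
  then have "e \<in> topspace (nsphere n)" by (simp add: nsphere e_def)
  moreover have "?g x n = 0" if "x \<in> topspace (nsphere n)" for x
    using h jn that unfolding continuous_map_Euclidean_iff by (auto simp: sphere_normalise_def)
  moreover have "e n = 1" by (simp add: e_def)
  ultimately have "e \<in> topspace (nsphere n)" "e \<notin> ?g ` topspace (nsphere n)"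
    by (blast, metis imageE zero_neq_one)
  then have "Brouwer_degree2 n ?g = 0"
    using g by (intro Brouwer_degree2_nonsurjective) auto
  moreover have "odd (Brouwer_degree2 n ?g)"
    by (rule odd_sphere_map_degree[OF b g]) (simp add: odd sphere_normalise_uminus)
  ultimately show False by simp
qed

section \<open>Strict convexity of the p-th power and the edge inequalities\<close>

text \<open>
  With exponent $p - 1 > 0$ instead of $p - 2$, monotonicity and continuity at $0$ become visible.
\<close>

lemma Phi_alt: "Phi p t = sgn t * \<bar>t\<bar> powr (p - 1)"
proof (cases "t = 0")
  case False
  then have "\<bar>t\<bar> powr (p - 1) = \<bar>t\<bar> powr (p - 2) * \<bar>t\<bar>"
    using powr_add[of "\<bar>t\<bar>" "p - 2" 1] by simp
  then show ?thesis using False by (simp add: Phi_def sgn_if)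
qed (simp add: Phi_def)

lemma Phi_0 [simp]: "Phi p 0 = 0"
  by (simp add: Phi_def)

lemma Phi_minus [simp]: "Phi p (- t) = - Phi p t"
  by (simp add: Phi_def)

lemma Phi_mult: "Phi p (s * t) = Phi p s * Phi p t"
  by (simp add: Phi_alt sgn_mult abs_mult powr_mult)

lemma Phi_1 [simp]: "Phi p 1 = 1"
  by (simp add: Phi_alt)

lemma Phi_self: "Phi p t * t = \<bar>t\<bar> powr p"
proof (cases "t = 0")
  case False
  then have "\<bar>t\<bar> powr p = \<bar>t\<bar> powr (p - 1) * \<bar>t\<bar>"
    using powr_add[of "\<bar>t\<bar>" "p - 1" 1] by simp
  then show ?thesis using False by (simp add: Phi_alt sgn_if)
qed simp

lemma Phi_strict_mono:
  assumes "p > 1" "s < t"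
  shows "Phi p s < Phi p t"
proof -
  consider "0 \<le> s" | "t \<le> 0" | "s < 0" "0 < t" by linarith
  then show ?thesis
  proof cases
    case 1
    then have "s powr (p - 1) < t powr (p - 1)" using assms by (intro powr_less_mono2) auto
    then show ?thesis using 1 assms(2) by (cases "s = 0") (auto simp: Phi_alt)
  next
    case 2
    then have "(- t) powr (p - 1) < (- s) powr (p - 1)" using assms by (intro powr_less_mono2) auto
    then show ?thesis using 2 assms(2) by (cases "t = 0") (auto simp: Phi_alt)
  next
    case 3
    then show ?thesis by (simp add: Phi_alt) (smt (verit) powr_gt_zero)
  qed
qed

lemma Phi_inj: "p > 1 \<Longrightarrow> Phi p s = Phi p t \<longleftrightarrow> s = t"
  by (metis Phi_strict_mono less_irrefl linorder_neqE_linordered_idom)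

lemma continuous_on_Phi [continuous_intros]:
  assumes "p > 1" "continuous_on S f"
  shows "continuous_on S (\<lambda>x. Phi p (f x))"
proof -
  have "continuous_on ({..0} \<union> {0..}) (\<lambda>t. if t \<le> 0 then - ((- t) powr (p - 1)) else t powr (p - 1))"
    using assms(1) by (intro continuous_on_If) (auto intro!: continuous_intros continuous_on_powr')
  also have "(\<lambda>t. if t \<le> 0 then - ((- t) powr (p - 1)) else t powr (p - 1)) = Phi p"
    by (auto simp: Phi_alt fun_eq_iff sgn_if)
  also have "{..0} \<union> {0..} = (UNIV :: real set)" by auto
  finally have "continuous_on UNIV (Phi p)" .
  then show ?thesis using continuous_on_compose2[OF _ assms(2), of UNIV "Phi p"] by auto
qed

lemma DERIV_abs_powr:
  assumes "p > 1"
  shows "((\<lambda>t. \<bar>t\<bar> powr p) has_real_derivative p * Phi p t) (at t)"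
proof (cases t "0::real" rule: linorder_cases)
  case less
  have "((\<lambda>t. (- t) powr p) has_real_derivative p * Phi p t) (at t)"
    using less by (auto intro!: derivative_eq_intros simp: Phi_alt)
  then show ?thesis
    by (rule has_field_derivative_transform_within_open[of _ _ _ "{..<0}"]) (use less in auto)
next
  case greater
  have "((\<lambda>t. t powr p) has_real_derivative p * Phi p t) (at t)"
    using greater by (auto intro!: derivative_eq_intros simp: Phi_alt)
  then show ?thesis
    by (rule has_field_derivative_transform_within_open[of _ _ _ "{0<..}"]) (use greater in auto)
next
  case equal
  have "continuous_on UNIV (Phi p)" using continuous_on_Phi[OF assms continuous_on_id] by simp
  then have "Phi p \<midarrow>0\<rightarrow> 0"
    using isContD[of 0 "Phi p"] by (simp add: continuous_on_eq_continuous_at)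
  moreover have "\<bar>h\<bar> powr p / h = Phi p h" for h
    using Phi_self[of p h] by (cases "h = 0") (auto simp: field_simps)
  ultimately show ?thesis using equal by (simp add: DERIV_def)
qed

text \<open>
  The derivative $p\,\Phi_p$ is strictly increasing, so the graph lies strictly above its tangents.
\<close>

lemma abs_powr_above_tangent:
  assumes "p > 1" "a \<noteq> b"
  shows "\<bar>b\<bar> powr p > \<bar>a\<bar> powr p + p * Phi p a * (b - a)"
proof (cases "a < b")
  case True
  obtain z where "a < z" "z < b" "\<bar>b\<bar> powr p - \<bar>a\<bar> powr p = (b - a) * (p * Phi p z)"
    using MVT2[OF True, of "\<lambda>t. \<bar>t\<bar> powr p" "\<lambda>t. p * Phi p t"] DERIV_abs_powr[OF assms(1)] by auto
  moreover have "(b - a) * (p * Phi p a) < (b - a) * (p * Phi p z)"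
    using True \<open>a < z\<close> assms(1) Phi_strict_mono[OF assms(1) \<open>a < z\<close>] by simp
  ultimately show ?thesis by (simp add: algebra_simps)
next
  case False
  then have "b < a" using assms(2) by simp
  obtain z where "b < z" "z < a" "\<bar>a\<bar> powr p - \<bar>b\<bar> powr p = (a - b) * (p * Phi p z)"
    using MVT2[OF \<open>b < a\<close>, of "\<lambda>t. \<bar>t\<bar> powr p" "\<lambda>t. p * Phi p t"] DERIV_abs_powr[OF assms(1)] by auto
  moreover have "(a - b) * (p * Phi p z) < (a - b) * (p * Phi p a)"
    using \<open>b < a\<close> \<open>z < a\<close> assms(1) Phi_strict_mono[OF assms(1) \<open>z < a\<close>] by simp
  ultimately show ?thesis by (simp add: algebra_simps)
qed

lemma abs_powr_strictly_convex:
  fixes p :: real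
  assumes p: "p > 1" and ab: "a \<noteq> b" and c: "\<alpha> > 0" "\<beta> > 0" "\<alpha> + \<beta> = 1"
  shows "\<bar>\<alpha> * a + \<beta> * b\<bar> powr p < \<alpha> * \<bar>a\<bar> powr p + \<beta> * \<bar>b\<bar> powr p"
proof -
  let ?c = "\<alpha> * a + \<beta> * b"
  have "a - ?c = (\<alpha> + \<beta>) * a - ?c" "b - ?c = (\<alpha> + \<beta>) * b - ?c" using c by simp_all
  then have ac: "a - ?c = \<beta> * (a - b)" and bc: "b - ?c = - \<alpha> * (a - b)"
    by (simp_all add: algebra_simps del: c(3))
  then have "?c \<noteq> a" "?c \<noteq> b" using ab c by auto
  then have "\<alpha> * (\<bar>?c\<bar> powr p + p * Phi p ?c * (a - ?c)) < \<alpha> * \<bar>a\<bar> powr p"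
    and "\<beta> * (\<bar>?c\<bar> powr p + p * Phi p ?c * (b - ?c)) < \<beta> * \<bar>b\<bar> powr p"
    using abs_powr_above_tangent[OF p] c by auto
  moreover have "\<alpha> * (\<bar>?c\<bar> powr p + p * Phi p ?c * (a - ?c)) + \<beta> * (\<bar>?c\<bar> powr p + p * Phi p ?c * (b - ?c))
      = (\<alpha> + \<beta>) * \<bar>?c\<bar> powr p"
    unfolding ac bc by (simp add: algebra_simps)
  ultimately show ?thesis unfolding c(3) by linarith
qed

text \<open>
  If $u > 0 > v$, then $(a u - b v)/(u - v)$ is a convex combination of $a$ and $b$ with weights
  $u/(u-v)$ and $-v/(u-v)$; the claim is strict convexity, multiplied by $(u-v)^p$.
\<close>

lemma edge_term_opposite_signs:
  assumes p: "p > 1" and uv: "u * v < 0" and ab: "a \<noteq> b"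
  shows "\<bar>a * u - b * v\<bar> powr p < Phi p (u - v) * (\<bar>a\<bar> powr p * u - \<bar>b\<bar> powr p * v)"
proof -
  have pos: "\<bar>a * u - b * v\<bar> powr p < Phi p (u - v) * (\<bar>a\<bar> powr p * u - \<bar>b\<bar> powr p * v)"
    if u: "u > 0" and v: "v < 0" for u v
  proof -
    define s where "s = u - v"
    have s: "s > 0" using u v by (simp add: s_def)
    have "\<bar>(u / s) * a + (- v / s) * b\<bar> powr p < (u / s) * \<bar>a\<bar> powr p + (- v / s) * \<bar>b\<bar> powr p"
      using p ab s u v by (intro abs_powr_strictly_convex) (auto simp: s_def divide_simps)
    moreover have "a * u - b * v = s * ((u / s) * a + (- v / s) * b)"
      using s by (simp add: field_simps)
    then have "\<bar>a * u - b * v\<bar> powr p = s powr p * \<bar>(u / s) * a + (- v / s) * b\<bar> powr p"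
      using s by (simp add: abs_mult powr_mult)
    moreover have "s powr p > 0" using s by simp
    ultimately have "\<bar>a * u - b * v\<bar> powr p < s powr p * ((u / s) * \<bar>a\<bar> powr p + (- v / s) * \<bar>b\<bar> powr p)"
      by simp
    also have "s powr p = Phi p s * s" using Phi_self[of p s] s by simp
    also have "Phi p s * s * ((u / s) * \<bar>a\<bar> powr p + (- v / s) * \<bar>b\<bar> powr p)
        = Phi p s * (\<bar>a\<bar> powr p * u - \<bar>b\<bar> powr p * v)"
      using s by (simp add: field_simps)
    finally show ?thesis by (simp add: s_def)
  qed
  show ?thesis
  proof (cases "u > 0")
    case True
    then show ?thesis using pos uv by (simp add: mult_less_0_iff)
  next
    case False
    then have "\<bar>a * (- u) - b * (- v)\<bar> powr p < Phi p (- u - - v) * (\<bar>a\<bar> powr p * (- u) - \<bar>b\<bar> powr p * (- v))"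
      using uv by (intro pos) (auto simp: mult_less_0_iff)
    moreover have "a * (- u) - b * (- v) = - (a * u - b * v)" "- u - - v = - (u - v)" by auto
    ultimately show ?thesis by (simp only: Phi_minus abs_minus_cancel) (simp add: algebra_simps)
  qed
qed

text \<open>
  The reverse inequality: if $u > v > 0$, then it is $a$ that is a convex combination, namely of $b$ and
  $(a u - b v)/(u - v)$ with weights $v/u$ and $(u-v)/u$.
\<close>

lemma edge_term_same_sign:
  assumes p: "p > 1" and uv: "u * v > 0" and ab: "a \<noteq> b"
  shows "Phi p (u - v) * (\<bar>a\<bar> powr p * u - \<bar>b\<bar> powr p * v) < \<bar>a * u - b * v\<bar> powr p"
proof -
  have larger: "Phi p (u - v) * (\<bar>a\<bar> powr p * u - \<bar>b\<bar> powr p * v) < \<bar>a * u - b * v\<bar> powr p"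
    if v: "v > 0" and vu: "v < u" and ab: "a \<noteq> b" for a b u v
  proof -
    define s where "s = u - v"
    have s: "s > 0" and u: "u > 0" using v vu by (simp_all add: s_def)
    define c where "c = (a * u - b * v) / s"
    have "b \<noteq> c"
    proof
      assume "b = c"
      then have "b * s = a * u - b * v" using s by (simp add: c_def eq_divide_eq)
      then have "u * (a - b) = 0" by (simp add: s_def algebra_simps) auto
      then show False using u ab by simp
    qed
    then have "\<bar>(v / u) * b + (s / u) * c\<bar> powr p < (v / u) * \<bar>b\<bar> powr p + (s / u) * \<bar>c\<bar> powr p"
      using p s u v by (intro abs_powr_strictly_convex) (auto simp: s_def divide_simps)
    moreover have "(v / u) * b + (s / u) * c = a"
      using s u by (simp add: c_def field_simps)
    ultimately have "u * \<bar>a\<bar> powr p < u * ((v / u) * \<bar>b\<bar> powr p + (s / u) * \<bar>c\<bar> powr p)"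
      using u by simp
    also have "\<dots> = v * \<bar>b\<bar> powr p + s * \<bar>c\<bar> powr p" using u by (simp add: field_simps)
    finally have "Phi p s * (u * \<bar>a\<bar> powr p - v * \<bar>b\<bar> powr p) < Phi p s * (s * \<bar>c\<bar> powr p)"
      using Phi_strict_mono[OF p s] by simp
    also have "\<dots> = s powr p * \<bar>c\<bar> powr p" using Phi_self[of p s] s by (simp add: algebra_simps)
    also have "\<dots> = \<bar>s * c\<bar> powr p" using s by (simp add: abs_mult powr_mult)
    also have "s * c = a * u - b * v" using s by (simp add: c_def)
    finally show ?thesis by (simp add: s_def mult.commute)
  qed
  have pos: "Phi p (u - v) * (\<bar>a\<bar> powr p * u - \<bar>b\<bar> powr p * v) < \<bar>a * u - b * v\<bar> powr p"
    if u: "u > 0" and v: "v > 0" for u v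
  proof (cases u v rule: linorder_cases)
    case less
    have "Phi p (v - u) * (\<bar>b\<bar> powr p * v - \<bar>a\<bar> powr p * u) < \<bar>b * v - a * u\<bar> powr p"
      using larger[OF u less] ab by auto
    moreover have "v - u = - (u - v)" "b * v - a * u = - (a * u - b * v)" by auto
    ultimately show ?thesis by (simp only: Phi_minus abs_minus_cancel) (simp add: algebra_simps)
  next
    case equal
    have "a * u - b * u \<noteq> 0" using ab u by simp
    then show ?thesis using equal by simp
  next
    case greater
    then show ?thesis using larger[OF v greater ab] by simp
  qed
  show ?thesis
  proof (cases "u > 0")
    case True
    then show ?thesis using pos uv by (simp add: zero_less_mult_iff)
  next
    case False
    then have "Phi p (- u - - v) * (\<bar>a\<bar> powr p * (- u) - \<bar>b\<bar> powr p * (- v)) < \<bar>a * (- u) - b * (- v)\<bar> powr p"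
      using uv by (intro pos) (auto simp: zero_less_mult_iff)
    moreover have "a * (- u) - b * (- v) = - (a * u - b * v)" "- u - - v = - (u - v)" by auto
    ultimately show ?thesis by (simp only: Phi_minus abs_minus_cancel) (simp add: algebra_simps)
  qed
qed

section \<open>The energy, its gradient, and a uniform descent step\<close>

locale signed_graph =
  fixes E :: "'v::finite set set"
    and w \<sigma> :: "'v set \<Rightarrow> real"
    and \<mu> \<kappa> :: "'v \<Rightarrow> real"
    and p :: real
  assumes w_pos: "e \<in> E \<Longrightarrow> w e > 0"
    and sigma: "e \<in> E \<Longrightarrow> \<sigma> e \<in> {-1, 1}"
    and mu_pos: "\<mu> x > 0"
    and p_gt_1: "p > 1"
begin

definition mass :: "real ^ 'v \<Rightarrow> real" where
  "mass g = (\<Sum>x\<in>UNIV. \<mu> x * \<bar>g $ x\<bar> powr p)"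

text \<open>
  On the unit sphere of \<open>mass\<close> this is the Rayleigh quotient minus \<open>l\<close>, but it is differentiable everywhere and
  $p$-homogeneous, so no quotient has to be differentiated.
\<close>

definition energy :: "real \<Rightarrow> real ^ 'v \<Rightarrow> real" where
  "energy l g = (\<Sum>x\<in>UNIV. \<Sum>y | {x, y} \<in> E. w {x, y} * \<bar>g $ x - \<sigma> {x, y} * g $ y\<bar> powr p) / 2
     + (\<Sum>x\<in>UNIV. \<kappa> x * \<bar>g $ x\<bar> powr p) - l * mass g"

text \<open>
  The gradient of \<open>energy l\<close> divided by $p$; its nonzero zeros are the eigenfunctions for \<open>l\<close>.
\<close>

definition grad :: "real \<Rightarrow> real ^ 'v \<Rightarrow> real ^ 'v" where
  "grad l g = (\<chi> x. p_laplacian E w \<kappa> \<sigma> p g x - l * \<mu> x * Phi p (g $ x))"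

lemma sigma_sq: "{x, y} \<in> E \<Longrightarrow> \<sigma> {x, y} * \<sigma> {x, y} = 1"
  using sigma[of "{x, y}"] by auto

lemma sum_edges_swap:
  "(\<Sum>x\<in>UNIV. \<Sum>y | {x, y} \<in> E. F x y) = (\<Sum>x\<in>UNIV. \<Sum>y | {x, y} \<in> E. (F y x :: real))"
proof -
  have "(\<Sum>x\<in>UNIV. \<Sum>y | {x, y} \<in> E. F x y) = (\<Sum>x\<in>UNIV. \<Sum>y\<in>UNIV. if {x, y} \<in> E then F x y else 0)"
    by (simp add: sum.If_cases)
  also have "\<dots> = (\<Sum>y\<in>UNIV. \<Sum>x\<in>UNIV. if {x, y} \<in> E then F x y else 0)"
    by (rule sum.swap)
  also have "\<dots> = (\<Sum>x\<in>UNIV. \<Sum>y | {x, y} \<in> E. F y x)"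
    by (simp add: sum.If_cases insert_commute)
  finally show ?thesis .
qed

lemma Phi_edge_swap:
  assumes "{x, y} \<in> E"
  shows "Phi p (g $ y - \<sigma> {y, x} * g $ x) = - \<sigma> {x, y} * Phi p (g $ x - \<sigma> {x, y} * g $ y)"
proof -
  have "g $ y - \<sigma> {y, x} * g $ x = - (\<sigma> {x, y} * (g $ x - \<sigma> {x, y} * g $ y))"
    using sigma_sq[OF assms] by (simp add: algebra_simps insert_commute) 
  moreover have "Phi p (\<sigma> {x, y}) = \<sigma> {x, y}" using sigma[OF assms] by auto
  ultimately show ?thesis by (simp only: Phi_minus Phi_mult)
qed

text \<open>
  Summation by parts: exchanging the ends of an edge multiplies its term by $-\sigma_{xy}$. With $h$ a direction
  this gives the derivative of the energy, with $h = |a|^p f$ the energy of a multiple $a f$.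
\<close>

lemma green_formula:
  "(\<Sum>x\<in>UNIV. h x * (\<Sum>y | {x, y} \<in> E. w {x, y} * Phi p (g $ x - \<sigma> {x, y} * g $ y)))
   = (\<Sum>x\<in>UNIV. \<Sum>y | {x, y} \<in> E. w {x, y} * (Phi p (g $ x - \<sigma> {x, y} * g $ y) * (h x - \<sigma> {x, y} * h y))) / 2"
proof -
  define F where "F x y = w {x, y} * Phi p (g $ x - \<sigma> {x, y} * g $ y) * h x" for x y
  let ?L = "\<Sum>x\<in>UNIV. \<Sum>y | {x, y} \<in> E. F x y"
  have "(\<Sum>x\<in>UNIV. \<Sum>y | {x, y} \<in> E. w {x, y} * (Phi p (g $ x - \<sigma> {x, y} * g $ y) * (h x - \<sigma> {x, y} * h y)))
      = (\<Sum>x\<in>UNIV. \<Sum>y | {x, y} \<in> E. F x y + F y x)"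
  proof (intro sum.cong refl)
    fix x y assume "y \<in> {y. {x, y} \<in> E}"
    then have "F y x = w {x, y} * (- \<sigma> {x, y} * Phi p (g $ x - \<sigma> {x, y} * g $ y)) * h y"
      using Phi_edge_swap[of x y g] by (simp add: F_def insert_commute)
    then show "w {x, y} * (Phi p (g $ x - \<sigma> {x, y} * g $ y) * (h x - \<sigma> {x, y} * h y)) = F x y + F y x"
      by (simp add: F_def algebra_simps)
  qed
  also have "\<dots> = ?L + (\<Sum>x\<in>UNIV. \<Sum>y | {x, y} \<in> E. F y x)"
    by (simp add: sum.distrib)
  also have "(\<Sum>x\<in>UNIV. \<Sum>y | {x, y} \<in> E. F y x) = ?L"
    by (rule sum_edges_swap[symmetric])
  finally show ?thesis by (simp add: F_def sum_distrib_left mult_ac)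
qed

lemma grad_inner:
  "(\<Sum>x\<in>UNIV. h x * grad l g $ x)
   = (\<Sum>x\<in>UNIV. \<Sum>y | {x, y} \<in> E. w {x, y} * (Phi p (g $ x - \<sigma> {x, y} * g $ y) * (h x - \<sigma> {x, y} * h y))) / 2
     + (\<Sum>x\<in>UNIV. \<kappa> x * (Phi p (g $ x) * h x)) - l * (\<Sum>x\<in>UNIV. \<mu> x * (Phi p (g $ x) * h x))"
  unfolding green_formula[symmetric] grad_def p_laplacian_def
  by (simp add: algebra_simps sum.distrib sum_subtractf sum_distrib_left)

lemma grad_uminus: "grad l (- g) = - grad l g"
proof -
  have "p_laplacian E w \<kappa> \<sigma> p (- g) x = - p_laplacian E w \<kappa> \<sigma> p g x" for x
  proof -
    have "Phi p (- g $ x + \<sigma> {x, y} * g $ y) = - Phi p (g $ x - \<sigma> {x, y} * g $ y)" for y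
      using Phi_minus[of p "g $ x - \<sigma> {x, y} * g $ y"] by simp
    then show ?thesis by (simp add: p_laplacian_def sum_negf)
  qed
  then show ?thesis by (simp add: grad_def vec_eq_iff)
qed

lemma continuous_on_abs_powr [continuous_intros]:
  "continuous_on S f \<Longrightarrow> continuous_on S (\<lambda>x. \<bar>f x :: real\<bar> powr p)"
  using p_gt_1 by (intro continuous_on_powr') (auto intro!: continuous_intros)

lemma continuous_energy: "continuous_on S (energy l)"
  unfolding energy_def mass_def by (intro continuous_intros) auto

lemma continuous_mass: "continuous_on S mass"
  unfolding mass_def by (intro continuous_intros)

lemma continuous_grad: "continuous_on S (grad l)"
  unfolding grad_def p_laplacian_def
  by (intro continuous_intros continuous_on_vec_lambda p_gt_1)

lemma DERIV_energy_line:
  "((\<lambda>t. energy l (g + t *\<^sub>R h)) has_real_derivative p * (grad l (g + t *\<^sub>R h) \<bullet> h)) (at t)"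
proof -
  have vertex: "((\<lambda>t. \<bar>a + t * b\<bar> powr p) has_real_derivative p * Phi p (a + t * b) * b) (at t)" for a b t
  proof -
    have "((\<lambda>t. a + t * b) has_real_derivative b) (at t)" by (auto intro!: derivative_eq_intros)
    then show ?thesis by (rule DERIV_chain2[OF DERIV_abs_powr[OF p_gt_1]])
  qed
  have edge: "((\<lambda>t. \<bar>a + t * b - s * (a' + t * b')\<bar> powr p) has_real_derivative
      p * Phi p (a + t * b - s * (a' + t * b')) * (b - s * b')) (at t)" for a b a' b' s t
    using vertex[of "a - s * a'" "b - s * b'" t] by (simp add: algebra_simps)
  let ?u = "g + t *\<^sub>R h"
  have comp: "(g + s *\<^sub>R h) $ x = g $ x + s * h $ x" for s x by simp
  have "((\<lambda>t. energy l (g + t *\<^sub>R h)) has_real_derivative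
     (\<Sum>x\<in>UNIV. \<Sum>y | {x, y} \<in> E. w {x, y} * (p * Phi p (?u $ x - \<sigma> {x, y} * ?u $ y) * (h $ x - \<sigma> {x, y} * h $ y))) / 2
     + (\<Sum>x\<in>UNIV. \<kappa> x * (p * Phi p (?u $ x) * h $ x)) - l * (\<Sum>x\<in>UNIV. \<mu> x * (p * Phi p (?u $ x) * h $ x))) (at t)"
    unfolding energy_def mass_def comp
    by (intro DERIV_diff DERIV_add DERIV_sum DERIV_cmult DERIV_cdivide vertex edge)
  also have "(\<Sum>x\<in>UNIV. \<Sum>y | {x, y} \<in> E. w {x, y} * (p * Phi p (?u $ x - \<sigma> {x, y} * ?u $ y) * (h $ x - \<sigma> {x, y} * h $ y))) / 2
     + (\<Sum>x\<in>UNIV. \<kappa> x * (p * Phi p (?u $ x) * h $ x)) - l * (\<Sum>x\<in>UNIV. \<mu> x * (p * Phi p (?u $ x) * h $ x))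
     = p * (\<Sum>x\<in>UNIV. h $ x * grad l ?u $ x)"
    unfolding grad_inner by (simp only: sum_distrib_left ring_distribs mult.left_commute[of _ p] mult.assoc times_divide_eq_right)
  also have "(\<Sum>x\<in>UNIV. h $ x * grad l ?u $ x) = grad l ?u \<bullet> h"
    by (simp add: inner_vec_def mult.commute)
  finally show ?thesis .
qed

text \<open>
  A gradient step of one fixed length \<open>t\<close> works on the whole compact set \<open>M\<close>. The condition on where the step lands is
  vacuous for \<open>C = UNIV\<close>; with a subspace for \<open>C\<close>, regularity is needed only at points of \<open>M\<close> in that subspace.
  If no \<open>t\<close> worked, the counterexamples for step lengths tending to $0$ would accumulate at a point
  of \<open>M\<close> and \<open>C\<close> of energy $0$; its gradient is nonzero, and the mean value theorem makes the energy decrease strictly for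
  all short steps that start nearby.
\<close>

lemma energy_descent_uniform:
  assumes M: "compact M" and C: "closed C"
    and le: "\<And>g. g \<in> M \<Longrightarrow> energy l g \<le> 0"
    and reg: "\<And>g. g \<in> M \<Longrightarrow> g \<in> C \<Longrightarrow> energy l g = 0 \<Longrightarrow> grad l g \<noteq> 0"
  obtains t where "t > 0" "\<And>g. g \<in> M \<Longrightarrow> g - t *\<^sub>R grad l g \<in> C \<Longrightarrow> energy l (g - t *\<^sub>R grad l g) < 0"
proof (rule ccontr)
  assume "\<not> thesis"
  then have "\<forall>t>0. \<exists>g\<in>M. g - t *\<^sub>R grad l g \<in> C \<and> energy l (g - t *\<^sub>R grad l g) \<ge> 0"
    using that by (meson not_le)
  then have "\<forall>n. \<exists>g. g \<in> M \<and> g - inverse (real (Suc n)) *\<^sub>R grad l g \<in> C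
      \<and> energy l (g - inverse (real (Suc n)) *\<^sub>R grad l g) \<ge> 0"
    by (meson inverse_positive_iff_positive of_nat_0_less_iff zero_less_Suc)
  then obtain u where u: "\<And>n. u n \<in> M" "\<And>n. u n - inverse (real (Suc n)) *\<^sub>R grad l (u n) \<in> C"
    "\<And>n. energy l (u n - inverse (real (Suc n)) *\<^sub>R grad l (u n)) \<ge> 0" by metis
  obtain g r where g: "g \<in> M" "strict_mono (r :: nat \<Rightarrow> nat)" "(u \<circ> r) \<longlonglongrightarrow> g"
    using M u(1) unfolding compact_def by metis
  define v where "v = u \<circ> r"
  define s where "s n = inverse (real (Suc (r n)))" for n
  have s0: "s n > 0" for n by (simp add: s_def)
  have "s = (\<lambda>n. inverse (real (Suc n))) \<circ> r" by (auto simp: s_def)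
  then have slim: "s \<longlonglongrightarrow> 0"
    using LIMSEQ_subseq_LIMSEQ[OF LIMSEQ_inverse_real_of_nat g(2)] by simp
  have vlim: "v \<longlonglongrightarrow> g" using g(3) by (simp add: v_def)
  have vM: "v n \<in> M" and vC: "v n - s n *\<^sub>R grad l (v n) \<in> C"
    and v0: "energy l (v n - s n *\<^sub>R grad l (v n)) \<ge> 0" for n
    using u by (simp_all add: v_def s_def)
  have cg: "isCont (grad l) x" and ce: "isCont (energy l) x" for x
    using continuous_grad[of UNIV] continuous_energy[of UNIV] by (auto simp: continuous_on_eq_continuous_at)
  have glim: "(\<lambda>n. grad l (v n)) \<longlonglongrightarrow> grad l g" by (rule isCont_tendsto_compose[OF cg vlim])
  have step: "(\<lambda>n. v n - \<tau> n *\<^sub>R grad l (v n)) \<longlonglongrightarrow> g" if "\<tau> \<longlonglongrightarrow> 0" for \<tau>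
  proof -
    have "(\<lambda>n. v n - \<tau> n *\<^sub>R grad l (v n)) \<longlonglongrightarrow> g - 0 *\<^sub>R grad l g"
      by (intro tendsto_intros vlim that glim)
    then show ?thesis by simp
  qed
  have gC: "g \<in> C" using closed_sequentially[OF C vC step[OF slim]] .
  have "energy l g \<ge> 0"
    using LIMSEQ_le_const[OF isCont_tendsto_compose[OF ce step[OF slim]]] v0 by auto
  then have "grad l g \<noteq> 0" using le[OF g(1)] reg[OF g(1) gC] by simp
  have "\<exists>\<tau>. 0 < \<tau> \<and> \<tau> < s n \<and> energy l (v n - s n *\<^sub>R grad l (v n)) - energy l (v n)
      = s n * (p * (grad l (v n - \<tau> *\<^sub>R grad l (v n)) \<bullet> (- grad l (v n))))" for n
    using MVT2[OF s0[of n], of "\<lambda>t. energy l (v n + t *\<^sub>R (- grad l (v n)))"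
        "\<lambda>t. p * (grad l (v n + t *\<^sub>R (- grad l (v n))) \<bullet> (- grad l (v n)))",
        OF DERIV_energy_line] by simp
  then obtain \<tau> where \<tau>: "\<And>n. 0 < \<tau> n" "\<And>n. \<tau> n < s n"
    "\<And>n. energy l (v n - s n *\<^sub>R grad l (v n)) - energy l (v n)
      = s n * (p * (grad l (v n - \<tau> n *\<^sub>R grad l (v n)) \<bullet> (- grad l (v n))))" by metis
  have "\<tau> \<longlonglongrightarrow> 0"
    by (rule tendsto_sandwich[OF _ _ tendsto_const slim]) (use \<tau> in \<open>auto intro!: always_eventually less_imp_le\<close>)
  then have "(\<lambda>n. grad l (v n - \<tau> n *\<^sub>R grad l (v n)) \<bullet> grad l (v n)) \<longlonglongrightarrow> grad l g \<bullet> grad l g"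
    by (intro tendsto_inner glim isCont_tendsto_compose[OF cg step])
  moreover have "grad l g \<bullet> grad l g > 0" using \<open>grad l g \<noteq> 0\<close> by simp
  ultimately have "\<forall>\<^sub>F n in sequentially. grad l (v n - \<tau> n *\<^sub>R grad l (v n)) \<bullet> grad l (v n) > 0"
    by (rule order_tendstoD)
  then obtain n where "grad l (v n - \<tau> n *\<^sub>R grad l (v n)) \<bullet> grad l (v n) > 0"
    by (auto simp: eventually_sequentially)
  then have "s n * (p * (grad l (v n - \<tau> n *\<^sub>R grad l (v n)) \<bullet> (- grad l (v n)))) < 0"
    using s0[of n] p_gt_1 by (simp add: mult_pos_neg)
  then show False using \<tau>(3)[of n] le[OF vM[of n]] v0[of n] by linarith
qed


lemma mass_pos: "g \<noteq> 0 \<Longrightarrow> mass g > 0"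
proof -
  assume "g \<noteq> 0"
  then obtain x where "g $ x \<noteq> 0" by (metis vec_eq_iff zero_index)
  then have "0 < \<mu> x * \<bar>g $ x\<bar> powr p" using mu_pos by simp
  also have "\<dots> \<le> mass g" unfolding mass_def
    by (intro member_le_sum) (auto simp: less_imp_le[OF mu_pos])
  finally show ?thesis .
qed

lemma mass_scale: "mass (c *\<^sub>R g) = \<bar>c\<bar> powr p * mass g"
  by (simp add: mass_def abs_mult powr_mult sum_distrib_left mult_ac)

lemma energy_scale: "energy l (c *\<^sub>R g) = \<bar>c\<bar> powr p * energy l g"
proof -
  have edge: "\<bar>(c *\<^sub>R g) $ x - s * (c *\<^sub>R g) $ y\<bar> powr p = \<bar>c\<bar> powr p * \<bar>g $ x - s * g $ y\<bar> powr p" for x y s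
  proof -
    have "(c *\<^sub>R g) $ x - s * (c *\<^sub>R g) $ y = c * (g $ x - s * g $ y)" by (simp add: algebra_simps)
    then show ?thesis by (simp only: abs_mult powr_mult)
  qed
  have "(\<Sum>x\<in>UNIV. \<Sum>y | {x, y} \<in> E. w {x, y} * \<bar>(c *\<^sub>R g) $ x - \<sigma> {x, y} * (c *\<^sub>R g) $ y\<bar> powr p)
      = \<bar>c\<bar> powr p * (\<Sum>x\<in>UNIV. \<Sum>y | {x, y} \<in> E. w {x, y} * \<bar>g $ x - \<sigma> {x, y} * g $ y\<bar> powr p)"
    unfolding edge by (simp add: sum_distrib_left mult.left_commute)
  moreover have "(\<Sum>x\<in>UNIV. \<kappa> x * \<bar>(c *\<^sub>R g) $ x\<bar> powr p) = \<bar>c\<bar> powr p * (\<Sum>x\<in>UNIV. \<kappa> x * \<bar>g $ x\<bar> powr p)"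
    by (simp add: abs_mult powr_mult sum_distrib_left mult.left_commute)
  ultimately show ?thesis
    unfolding energy_def mass_scale by (simp only:) (simp add: algebra_simps)
qed

lemma energy_0 [simp]: "energy l 0 = 0"
  by (simp add: energy_def mass_def)

lemma sphere_iff: "g \<in> p_sphere \<mu> p \<longleftrightarrow> mass g = 1"
  by (simp add: p_sphere_def mass_def)

lemma sphere_nonzero: "g \<in> p_sphere \<mu> p \<Longrightarrow> g \<noteq> 0"
  by (auto simp: sphere_iff mass_def)

lemma sphere_uminus: "- g \<in> p_sphere \<mu> p \<longleftrightarrow> g \<in> p_sphere \<mu> p"
  by (simp add: sphere_iff mass_def)

lemma rayleigh_on_sphere:
  "g \<in> p_sphere \<mu> p \<Longrightarrow> rayleigh E w \<mu> \<kappa> \<sigma> p g = energy l g + l"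
  by (simp add: rayleigh_def energy_def sphere_iff) (simp add: mass_def)

lemma compact_sphere: "compact (p_sphere \<mu> p)"
proof -
  have "p_sphere \<mu> p = {g. mass g = 1}" by (auto simp: sphere_iff)
  moreover have "closed {g. mass g = 1}"
    by (intro closed_Collect_eq continuous_mass continuous_on_const)
  moreover have "norm g \<le> (\<Sum>x\<in>UNIV. (1 / \<mu> x) powr (1 / p))" if "mass g = 1" for g
  proof -
    have "\<bar>g $ x\<bar> \<le> (1 / \<mu> x) powr (1 / p)" for x
    proof -
      have "\<mu> x * \<bar>g $ x\<bar> powr p \<le> 1"
        unfolding that[symmetric] mass_def
        by (intro member_le_sum) (auto simp: less_imp_le[OF mu_pos])
      then have "\<bar>g $ x\<bar> powr p \<le> 1 / \<mu> x" using mu_pos[of x] by (simp add: field_simps)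
      then have "(\<bar>g $ x\<bar> powr p) powr (1 / p) \<le> (1 / \<mu> x) powr (1 / p)"
        using p_gt_1 by (intro powr_mono2) auto
      then show ?thesis using p_gt_1 by (simp add: powr_powr)
    qed
    then have "(\<Sum>x\<in>UNIV. \<bar>g $ x\<bar>) \<le> (\<Sum>x\<in>UNIV. (1 / \<mu> x) powr (1 / p))"
      by (intro sum_mono) auto
    then show ?thesis using norm_le_l1_cart[of g] by linarith
  qed
  then have "bounded {g. mass g = 1}" unfolding bounded_iff by blast
  ultimately show ?thesis by (simp add: compact_eq_bounded_closed)
qed

definition normalise :: "real ^ 'v \<Rightarrow> real ^ 'v" where
  "normalise g = (mass g powr (- 1 / p)) *\<^sub>R g"

lemma normalise_in_sphere: "g \<noteq> 0 \<Longrightarrow> normalise g \<in> p_sphere \<mu> p"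
proof -
  assume "g \<noteq> 0"
  then have m: "mass g > 0" by (rule mass_pos)
  have "(mass g powr (- 1 / p)) powr p = mass g powr (- 1)"
    unfolding powr_powr using p_gt_1 by simp
  also have "\<dots> = 1 / mass g" using m by (simp add: powr_minus_divide)
  finally show ?thesis using m by (simp add: sphere_iff normalise_def mass_scale)
qed

lemma normalise_uminus: "normalise (- g) = - normalise g"
  by (simp add: normalise_def mass_def)

lemma continuous_on_normalise: "0 \<notin> S \<Longrightarrow> continuous_on S normalise"
  unfolding normalise_def
  by (intro continuous_on_scaleR continuous_on_powr continuous_mass continuous_on_id continuous_on_const)
     (metis less_irrefl mass_pos)

lemma energy_normalise_neg: "energy l g < 0 \<Longrightarrow> energy l (normalise g) < 0"
proof -
  assume e: "energy l g < 0"
  then have "g \<noteq> 0" by auto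
  then have "\<bar>mass g powr (- 1 / p)\<bar> powr p > 0" using mass_pos[of g] by simp
  then show ?thesis unfolding normalise_def energy_scale using e by (rule mult_pos_neg)
qed

lemma normalise_in_subspace: "subspace X \<Longrightarrow> g \<in> X \<Longrightarrow> normalise g \<in> X"
  by (simp add: normalise_def subspace_scale)

end

section \<open>Genus bounds and the variational eigenvalues\<close>

text \<open>
  An odd map of \<open>S\<close> to a space of dimension at most $n$, composed with \<open>u\<close>, would contradict the Borsuk--Ulam theorem.
\<close>

lemma genus_ge_of_odd_sphere_map:
  fixes b :: "nat \<Rightarrow> 'v::finite" and S :: "'a::real_normed_vector set"
  assumes b: "inj_on b {..n}"
    and u: "continuous_map (nsphere n) (top_of_set S) u"
    and odd: "\<And>x. x \<in> topspace (nsphere n) \<Longrightarrow> u (\<lambda>i. - x i) = - u x"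
  shows "enat (Suc n) \<le> genus S"
proof -
  have uS: "u x \<in> S" if "x \<in> topspace (nsphere n)" for x
    using u that by (auto simp: continuous_map_def)
  then have "S \<noteq> {}" using in_topspace_nsphere[of n] by blast
  moreover have "enat (Suc n) \<le> enat j" if h: "odd_map_into j S h" for j h
  proof (rule ccontr)
    assume "\<not> ?thesis"
    then have "j \<le> n" by simp
    then show False
    proof (rule Borsuk_Ulam_no_odd_map[OF b])
      show "continuous_map (nsphere n) (Euclidean_space j) (h \<circ> u)"
        using h by (intro continuous_map_compose[OF u]) (auto simp: odd_map_into_def)
    qed (use h uS odd in \<open>auto simp: odd_map_into_def\<close>)
  qed
  ultimately show ?thesis by (auto simp: genus_def intro!: Inf_greatest)
qed

text \<open>
  The inner products of \<open>\<phi> s\<close> with a basis of the orthogonal complement of \<open>X\<close> vanish simultaneously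
  only if \<open>\<phi> s\<close> lies in \<open>X\<close>.
\<close>

lemma genus_le_codim:
  fixes S :: "'a::real_normed_vector set" and X :: "'b::euclidean_space set"
  assumes X: "subspace X" and S: "S \<noteq> {}"
    and \<phi>: "continuous_on S \<phi>" "\<And>s. s \<in> S \<Longrightarrow> \<phi> (- s) = - \<phi> s" "\<And>s. s \<in> S \<Longrightarrow> \<phi> s \<notin> X"
  shows "genus S \<le> enat (DIM('b) - dim X)"
proof -
  let ?d = "DIM('b) - dim X"
  have "dim {y \<in> UNIV. \<forall>x\<in>X. orthogonal x y} + dim X = dim (UNIV :: 'b set)"
    by (rule dim_subspace_orthogonal_to_vectors) (use X in auto)
  then have dX: "dim (orthogonal_comp X) = ?d" by (simp add: orthogonal_comp_def)
  obtain B where B: "B \<subseteq> orthogonal_comp X" "independent B" "card B = ?d" "span B = orthogonal_comp X"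
    using orthonormal_basis_subspace[OF subspace_orthogonal_comp[of X]] dX by metis
  have "finite B" using B(2) by (rule independent_imp_finite)
  then obtain c where c: "bij_betw c {..<?d} B"
    using B(3) by (metis ex_bij_betw_nat_finite lessThan_atLeast0)
  have nz: "\<exists>i<?d. y \<bullet> c i \<noteq> 0" if "y \<notin> X" for y
  proof (rule ccontr)
    assume "\<not> ?thesis"
    then have "\<And>v. v \<in> B \<Longrightarrow> orthogonal y v"
      using c by (force simp: orthogonal_def bij_betw_def)
    then have "\<And>v. v \<in> orthogonal_comp X \<Longrightarrow> orthogonal y v"
      using orthogonal_to_span[of _ B y] B(4) by blast
    then have "y \<in> orthogonal_comp (orthogonal_comp X)"
      by (auto simp: orthogonal_comp_def orthogonal_commute)
    then show False using that X by (simp add: orthogonal_comp_self)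
  qed
  obtain s where "s \<in> S" using S by blast
  then have "?d \<ge> 1" using nz[OF \<phi>(3)] by fastforce
  moreover have "odd_map_into ?d S (\<lambda>s i. if i < ?d then \<phi> s \<bullet> c i else 0)"
    unfolding odd_map_into_def continuous_map_componentwise_Euclidean_space
    using nz[OF \<phi>(3)] \<phi>(2)
    by (auto simp: continuous_map_iff_continuous fun_eq_iff intro!: continuous_intros \<phi>(1))
  ultimately show ?thesis using S unfolding genus_def by (auto intro!: Inf_lower)
qed

context signed_graph
begin

text \<open>
  The round sphere of dimension $\dim X - 1$ maps oddly to the sphere of \<open>X\<close> by means of a basis of \<open>X\<close>.
\<close>

lemma genus_odd_image_of_subspace_sphere:
  fixes \<phi> :: "real ^ 'v \<Rightarrow> 'a::real_normed_vector"
  assumes X: "subspace X" and k: "1 \<le> k" "k \<le> dim X"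
    and \<phi>: "continuous_on (X \<inter> p_sphere \<mu> p) \<phi>"
      "\<And>g. g \<in> X \<inter> p_sphere \<mu> p \<Longrightarrow> \<phi> (- g) = - \<phi> g"
  shows "enat k \<le> genus (\<phi> ` (X \<inter> p_sphere \<mu> p))"
proof -
  obtain B where B: "B \<subseteq> X" "independent B" "card B = dim X" "span B = X"
    using orthonormal_basis_subspace[OF X] by metis
  have "finite B" using B(2) by (rule independent_imp_finite)
  then obtain c where c: "bij_betw c {..<dim X} B"
    using B(3) by (metis ex_bij_betw_nat_finite lessThan_atLeast0)
  define n where "n = dim X - 1"
  have n: "{..<dim X} = {..n}" "Suc n = dim X" using k by (auto simp: n_def)
  have "dim X \<le> CARD('v)" using dim_subset_UNIV[of X] by simp
  moreover obtain b :: "nat \<Rightarrow> 'v" where "bij_betw b {..<CARD('v)} UNIV"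
    using ex_bij_betw_nat_finite[of "UNIV :: 'v set"] by (auto simp: lessThan_atLeast0)
  ultimately have b: "inj_on b {..n}"
    using n by (auto simp: bij_betw_def intro: inj_on_subset)
  define v where "v x = (\<Sum>i\<le>n. x i *\<^sub>R c i)" for x :: "nat \<Rightarrow> real"
  have cB: "c i \<in> B" if "i \<le> n" for i using c that n by (auto simp: bij_betw_def)
  have vX: "v x \<in> X" for x
    unfolding v_def using cB B(1) by (intro subspace_sum[OF X] subspace_scale[OF X]) auto
  have vm: "v (\<lambda>i. - x i) = - v x" for x by (simp add: v_def sum_negf)
  have vnz: "v x \<noteq> 0" if x: "x \<in> topspace (nsphere n)" for x
  proof
    assume "v x = 0"
    have inj: "inj_on c {..n}" using c n by (auto simp: bij_betw_def)
    have "(\<Sum>y\<in>B. x (the_inv_into {..n} c y) *\<^sub>R y) = v x"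
      using c n inj unfolding v_def
      by (subst bij_betw_imp_surj_on[OF c, symmetric])
         (simp add: sum.reindex the_inv_into_f_f)
    then have z: "(\<Sum>y\<in>B. x (the_inv_into {..n} c y) *\<^sub>R y) = 0" using \<open>v x = 0\<close> by simp
    have "x i = 0" if "i \<le> n" for i
    proof -
      have "x (the_inv_into {..n} c (c i)) = 0"
      proof -
        have "\<forall>y\<in>B. x (the_inv_into {..n} c y) = 0"
          using B(2) z unfolding independent_explicit by (elim conjE allE impE) (assumption+)
        then show ?thesis using cB[OF that] by blast
      qed
      then show ?thesis using inj that by (simp add: the_inv_into_f_f)
    qed
    then have "(\<Sum>i\<le>n. (x i)\<^sup>2) = 0" by simp
    then show False using x by (simp add: nsphere)
  qed
  have "continuous_map (nsphere n) euclidean (\<lambda>x. x i *\<^sub>R c i)" for i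
    using continuous_map_compose[OF continuous_map_nsphere_projection[of n i],
        of euclidean "\<lambda>t. t *\<^sub>R c i"]
    by (simp add: o_def continuous_intros)
  then have "continuous_map (nsphere n) euclidean v"
    unfolding v_def by (intro continuous_intros) auto
  then have vc: "continuous_map (nsphere n) (top_of_set (X - {0})) v"
    using vX vnz by (auto simp: continuous_map_in_subtopology)
  have nc: "continuous_map (top_of_set (X - {0})) (top_of_set (X \<inter> p_sphere \<mu> p)) normalise"
    using normalise_in_sphere normalise_in_subspace[OF X] by (auto intro!: continuous_on_normalise)
  have \<phi>c: "continuous_map (top_of_set (X \<inter> p_sphere \<mu> p)) (top_of_set (\<phi> ` (X \<inter> p_sphere \<mu> p))) \<phi>"
    using \<phi>(1) by auto
  let ?u = "\<phi> \<circ> normalise \<circ> v"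
  have "continuous_map (nsphere n) (top_of_set (\<phi> ` (X \<inter> p_sphere \<mu> p))) ?u"
    by (intro continuous_map_compose[OF vc] continuous_map_compose[OF nc \<phi>c])
  moreover have "?u (\<lambda>i. - x i) = - ?u x" if "x \<in> topspace (nsphere n)" for x
    using \<phi>(2) vX vnz[OF that] normalise_in_sphere normalise_in_subspace[OF X]
    by (simp add: vm normalise_uminus)
  ultimately have "enat (Suc n) \<le> genus (\<phi> ` (X \<inter> p_sphere \<mu> p))"
    by (rule genus_ge_of_odd_sphere_map[OF b])
  moreover have "enat k \<le> enat (Suc n)" using k n by simp
  ultimately show ?thesis by (rule order_trans[rotated])
qed

abbreviation eigval :: "nat \<Rightarrow> real" where
  "eigval \<equiv> variational_eigenvalue E w \<mu> \<kappa> \<sigma> p"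

lemma genus_family_nonempty_member:
  "1 \<le> k \<Longrightarrow> S \<in> genus_family k Y \<Longrightarrow> S \<noteq> {}"
  by (auto simp: genus_family_def genus_def zero_enat_def)

lemma sphere_in_genus_family:
  assumes "1 \<le> k" "k \<le> CARD('v)"
  shows "p_sphere \<mu> p \<in> genus_family k (p_sphere \<mu> p)"
proof -
  have "enat k \<le> genus ((\<lambda>g. g) ` (UNIV \<inter> p_sphere \<mu> p))"
    using assms by (intro genus_odd_image_of_subspace_sphere) (auto simp: dim_UNIV)
  moreover have "uminus ` p_sphere \<mu> p = p_sphere \<mu> p"
    using sphere_uminus by (force simp: image_iff)
  ultimately show ?thesis using compact_sphere by (simp add: genus_family_def)
qed

lemma rayleigh_bounded_on_sphere:
  obtains K where "\<And>g. g \<in> p_sphere \<mu> p \<Longrightarrow> \<bar>rayleigh E w \<mu> \<kappa> \<sigma> p g\<bar> \<le> K"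
proof -
  have "compact (energy 0 ` p_sphere \<mu> p)"
    by (intro compact_continuous_image continuous_energy compact_sphere)
  then have "bounded (energy 0 ` p_sphere \<mu> p)" by (rule compact_imp_bounded)
  then obtain K where "\<forall>g\<in>p_sphere \<mu> p. \<bar>energy 0 g\<bar> \<le> K"
    unfolding bounded_iff by auto
  then show thesis by (intro that[of K]) (simp add: rayleigh_on_sphere[where l = 0])
qed

text \<open>
  The sphere of \<open>X\<close>, moved by one descent step, is a set of genus at least \<open>k\<close> with maximal Rayleigh quotient below \<open>l\<close>.
\<close>

lemma eigval_less_if_nonpositive_on_subspace:
  assumes X: "subspace X" and k: "1 \<le> k" "k \<le> dim X"
    and le: "\<And>g. g \<in> X \<Longrightarrow> energy l g \<le> 0"
    and reg: "\<And>g. g \<in> X \<Longrightarrow> g \<noteq> 0 \<Longrightarrow> energy l g = 0 \<Longrightarrow> grad l g \<noteq> 0"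
  shows "eigval k < l"
proof -
  let ?A = "X \<inter> p_sphere \<mu> p"
  have cA: "compact ?A" using X compact_sphere by (intro closed_Int_compact closed_subspace)
  obtain t where t: "\<And>g. g \<in> ?A \<Longrightarrow> energy l (g - t *\<^sub>R grad l g) < 0"
  proof (rule energy_descent_uniform[OF cA closed_UNIV, of l])
    show "energy l g \<le> 0" if "g \<in> ?A" for g using that le by blast
    show "grad l g \<noteq> 0" if "g \<in> ?A" "energy l g = 0" for g
      using that reg[of g] sphere_nonzero[of g] by blast
  qed blast
  define \<eta> where "\<eta> g = normalise (g - t *\<^sub>R grad l g)" for g
  let ?S = "\<eta> ` ?A"
  have nz: "g - t *\<^sub>R grad l g \<noteq> 0" if "g \<in> ?A" for g using t[OF that] by auto
  have c: "continuous_on ?A \<eta>"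
    unfolding \<eta>_def
    by (intro continuous_on_compose2[OF continuous_on_normalise[of "- {0}"]])
       (use nz in \<open>auto intro!: continuous_intros continuous_grad\<close>)
  have odd: "\<eta> (- g) = - \<eta> g" for g
  proof -
    have "- g - t *\<^sub>R grad l (- g) = - (g - t *\<^sub>R grad l g)" by (simp add: grad_uminus)
    then show ?thesis by (simp only: \<eta>_def normalise_uminus)
  qed
  have "enat k \<le> genus ?S"
    by (rule genus_odd_image_of_subspace_sphere[OF X k c odd])
  moreover have cS: "compact ?S" using c cA by (rule compact_continuous_image)
  moreover have SS: "?S \<subseteq> p_sphere \<mu> p" using nz normalise_in_sphere by (auto simp: \<eta>_def)
  moreover have "uminus ` ?A = ?A"
    using sphere_uminus subspace_neg[OF X] by (force simp: image_iff)
  then have "uminus ` ?S = ?S"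
    by (metis (mono_tags, lifting) image_cong image_image odd)
  ultimately have fam: "?S \<in> genus_family k (p_sphere \<mu> p)" by (simp add: genus_family_def)
  let ?R = "rayleigh E w \<mu> \<kappa> \<sigma> p"
  obtain K where K: "\<And>g. g \<in> p_sphere \<mu> p \<Longrightarrow> \<bar>?R g\<bar> \<le> K" using rayleigh_bounded_on_sphere by blast
  have "bdd_below ((\<lambda>S. SUP f\<in>S. ?R f) ` genus_family k (p_sphere \<mu> p))"
  proof (rule bdd_belowI2)
    fix S assume S: "S \<in> genus_family k (p_sphere \<mu> p)"
    then obtain g where g: "g \<in> S" using genus_family_nonempty_member[OF k(1)] by blast
    have sub: "S \<subseteq> p_sphere \<mu> p" using S by (simp add: genus_family_def)
    then have "bdd_above (?R ` S)" using K by (intro bdd_aboveI2[of _ _ K]) (meson abs_le_D1 subsetD)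
    then have "?R g \<le> (SUP f\<in>S. ?R f)" using g by (rule cSUP_upper2) simp
    moreover have "- K \<le> ?R g" using K[of g] g sub by fastforce
    ultimately show "- K \<le> (SUP f\<in>S. ?R f)" by simp
  qed
  then have "eigval k \<le> (SUP f\<in>?S. ?R f)"
    unfolding variational_eigenvalue_def using fam by (rule cINF_lower)
  moreover have "?S \<noteq> {}" using genus_family_nonempty_member[OF k(1) fam] .
  then obtain g where g: "g \<in> ?S" "\<forall>h\<in>?S. energy l h \<le> energy l g"
    using continuous_attains_sup[OF cS _ continuous_energy] by blast
  have "energy l g < 0" using g(1) t energy_normalise_neg by (auto simp: \<eta>_def)
  moreover have "(SUP f\<in>?S. ?R f) \<le> energy l g + l"
  proof (rule cSUP_least[OF \<open>?S \<noteq> {}\<close>])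
    fix h assume "h \<in> ?S"
    then show "?R h \<le> energy l g + l" using g(2) SS rayleigh_on_sphere[of h l] by fastforce
  qed
  ultimately show ?thesis by linarith
qed

text \<open>
  A linking argument. The descent step sends no point of nonpositive energy into \<open>X\<close>, because the energy after the step would be
  negative there. By compactness the same holds for all points of energy less than some \<open>\<epsilon> > 0\<close>. A set of
  genus at least \<open>k\<close> cannot be moved off \<open>X\<close>, whose codimension is less than \<open>k\<close>; so it contains a point
  of energy at least \<open>\<epsilon>\<close>.
\<close>

lemma eigval_greater_if_nonnegative_on_subspace:
  assumes X: "subspace X" and k: "1 \<le> k" "k \<le> CARD('v)" "CARD('v) < k + dim X"
    and ge: "\<And>g. g \<in> X \<Longrightarrow> energy l g \<ge> 0"
    and reg: "\<And>g. g \<in> X \<Longrightarrow> g \<noteq> 0 \<Longrightarrow> energy l g = 0 \<Longrightarrow> grad l g \<noteq> 0"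
  shows "l < eigval k"
proof -
  let ?M = "p_sphere \<mu> p \<inter> {g. energy l g \<le> 0}"
  have "compact ?M"
    by (intro compact_Int_closed compact_sphere closed_Collect_le continuous_energy continuous_on_const)
  then obtain t where t: "\<And>g. g \<in> ?M \<Longrightarrow> g - t *\<^sub>R grad l g \<in> X \<Longrightarrow> energy l (g - t *\<^sub>R grad l g) < 0"
  proof (rule energy_descent_uniform[OF _ closed_subspace[OF X], of ?M l])
    show "energy l g \<le> 0" if "g \<in> ?M" for g using that by blast
    show "grad l g \<noteq> 0" if "g \<in> ?M" "g \<in> X" "energy l g = 0" for g
      using that reg[of g] sphere_nonzero[of g] by blast
  qed blast
  \<comment> \<open>The points that the descent step sends into \<open>X\<close>; the gap \<open>\<epsilon>\<close> is the minimum of the energy over them, or arbitrary if there are none.\<close>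
  let ?B = "p_sphere \<mu> p \<inter> {g. g - t *\<^sub>R grad l g \<in> X}"
  have cd: "continuous_on UNIV (\<lambda>g. g - t *\<^sub>R grad l g)"
    by (intro continuous_intros continuous_grad)
  have cB: "compact ?B"
    using continuous_closed_vimage[OF closed_subspace[OF X], of "\<lambda>g. g - t *\<^sub>R grad l g"] cd
    by (intro compact_Int_closed compact_sphere) (simp add: vimage_def continuous_on_eq_continuous_at)
  have posB: "energy l g > 0" if "g \<in> ?B" for g
    using that t[of g] ge[of "g - t *\<^sub>R grad l g"] by fastforce
  obtain \<epsilon> where \<epsilon>: "\<epsilon> > 0" "\<And>g. g \<in> ?B \<Longrightarrow> \<epsilon> \<le> energy l g"
  proof (cases "?B = {}")
    case True
    show thesis
    proof (rule that[of 1])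
      show "1 \<le> energy l g" if "g \<in> ?B" for g using that True by blast
    qed simp
  next
    case False
    obtain g where g: "g \<in> ?B" "\<forall>h\<in>?B. energy l g \<le> energy l h"
      using continuous_attains_inf[OF cB False continuous_energy] by blast
    show thesis by (rule that[of "energy l g"]) (use g posB in blast)+
  qed
  let ?R = "rayleigh E w \<mu> \<kappa> \<sigma> p"
  obtain K where K: "\<And>g. g \<in> p_sphere \<mu> p \<Longrightarrow> \<bar>?R g\<bar> \<le> K" using rayleigh_bounded_on_sphere by blast
  have "l + \<epsilon> \<le> eigval k"
    unfolding variational_eigenvalue_def
  proof (rule cINF_greatest)
    show "genus_family k (p_sphere \<mu> p) \<noteq> {}" using sphere_in_genus_family[OF k(1,2)] by blast
    fix S assume S: "S \<in> genus_family k (p_sphere \<mu> p)"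
    have sub: "S \<subseteq> p_sphere \<mu> p" and gen: "enat k \<le> genus S"
      using S by (auto simp: genus_family_def)
    have "\<exists>g\<in>S. g - t *\<^sub>R grad l g \<in> X"
    proof (rule ccontr)
      assume "\<not> ?thesis"
      then have "genus S \<le> enat (DIM(real ^ 'v) - dim X)"
        by (intro genus_le_codim[OF X genus_family_nonempty_member[OF k(1) S],
              of "\<lambda>g. g - t *\<^sub>R grad l g"])
           (auto simp: grad_uminus intro!: continuous_intros continuous_grad)
      then have "enat k \<le> enat (DIM(real ^ 'v) - dim X)" using gen by (rule order_trans[rotated])
      then show False using k by simp
    qed
    then obtain g where g: "g \<in> S" "g \<in> ?B" using sub by blast
    have "bdd_above (?R ` S)" using K sub by (intro bdd_aboveI2[of _ _ K]) (meson abs_le_D1 subsetD)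
    then have "?R g \<le> (SUP f\<in>S. ?R f)" using g(1) by (rule cSUP_upper2) simp
    then show "l + \<epsilon> \<le> (SUP f\<in>S. ?R f)"
      using \<epsilon>(2)[OF g(2)] g sub rayleigh_on_sphere[of g l] by auto
  qed
  then show ?thesis using \<epsilon>(1) by linarith
qed

end

section \<open>Weak nodal domains as equivalence classes\<close>

lemma weak_nodal_walk_rev:
  assumes "weak_nodal_walk E s f xs"
  shows "weak_nodal_walk E s f (rev xs)"
proof -
  let ?n = "length xs"
  have len: "?n \<ge> 2" and edge: "\<And>i. Suc i < ?n \<Longrightarrow> {xs ! i, xs ! Suc i} \<in> E"
    and pos: "\<And>i j. i < j \<Longrightarrow> j < ?n \<Longrightarrow> f $ (xs ! i) \<noteq> 0 \<Longrightarrow> f $ (xs ! j) \<noteq> 0 \<Longrightarrow>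
       (\<And>l. i < l \<Longrightarrow> l < j \<Longrightarrow> f $ (xs ! l) = 0) \<Longrightarrow>
       f $ (xs ! i) * (\<Prod>l = i..<j. s {xs ! l, xs ! Suc l}) * f $ (xs ! j) > 0"
    using assms unfolding weak_nodal_walk_def by auto
  have nth: "rev xs ! i = xs ! (?n - Suc i)" if "i < ?n" for i using that by (rule rev_nth)
  have "{rev xs ! i, rev xs ! Suc i} \<in> E" if "Suc i < ?n" for i
  proof -
    have "Suc (?n - Suc (Suc i)) = ?n - Suc i" using that by simp
    then show ?thesis using edge[of "?n - Suc (Suc i)"] that by (simp add: nth insert_commute)
  qed
  moreover have "f $ (rev xs ! i) * (\<Prod>l = i..<j. s {rev xs ! l, rev xs ! Suc l}) * f $ (rev xs ! j) > 0"
    if ij: "i < j" "j < ?n" and nz: "f $ (rev xs ! i) \<noteq> 0" "f $ (rev xs ! j) \<noteq> 0"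
      and z: "\<forall>l. i < l \<and> l < j \<longrightarrow> f $ (rev xs ! l) = 0" for i j
  proof -
    let ?i = "?n - Suc j" and ?j = "?n - Suc i"
    have "(\<Prod>l = i..<j. s {rev xs ! l, rev xs ! Suc l}) = (\<Prod>l = ?i..<?j. s {xs ! l, xs ! Suc l})"
    proof (rule prod.reindex_bij_witness[of _ "\<lambda>l. ?n - 2 - l" "\<lambda>l. ?n - 2 - l"])
      fix l assume l: "l \<in> {i..<j}"
      have "rev xs ! l = xs ! Suc (?n - 2 - l)"
        using nth[of l] l ij by (simp add: Suc_diff_Suc numeral_2_eq_2)
      moreover have "rev xs ! Suc l = xs ! (?n - 2 - l)"
        using nth[of "Suc l"] l ij by (simp add: numeral_2_eq_2)
      ultimately show "s {xs ! (?n - 2 - l), xs ! Suc (?n - 2 - l)} = s {rev xs ! l, rev xs ! Suc l}"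
        by (simp only: insert_commute)
    qed (use ij in auto)
    moreover have "f $ (xs ! ?i) * (\<Prod>l = ?i..<?j. s {xs ! l, xs ! Suc l}) * f $ (xs ! ?j) > 0"
    proof (rule pos)
      fix l assume "?i < l" "l < ?j"
      then have "i < ?n - Suc l" "?n - Suc l < j" "?n - Suc (?n - Suc l) = l" "?n - Suc l < ?n"
        using ij by auto
      then show "f $ (xs ! l) = 0" using z nth[of "?n - Suc l"] by metis
    qed (use ij nz nth in auto)
    ultimately show ?thesis using ij nth by (simp add: mult_ac)
  qed
  ultimately show ?thesis using len unfolding weak_nodal_walk_def by auto
qed

text \<open>
  Consecutive nonzero values of the joined walk lie both in the first or both in the second walk, because
  the value at the junction is nonzero.
\<close>

lemma weak_nodal_walk_append:
  assumes xs: "weak_nodal_walk E s f xs" and ys: "weak_nodal_walk E s f ys"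
    and join: "last xs = hd ys" and nz: "f $ hd ys \<noteq> 0"
  shows "weak_nodal_walk E s f (xs @ tl ys)"
proof -
  let ?zs = "xs @ tl ys"
  have posx: "f $ (xs ! i) * (\<Prod>l = i..<j. s {xs ! l, xs ! Suc l}) * f $ (xs ! j) > 0"
    if "i < j" "j < length xs" "f $ (xs ! i) \<noteq> 0" "f $ (xs ! j) \<noteq> 0"
       "\<And>l. i < l \<Longrightarrow> l < j \<Longrightarrow> f $ (xs ! l) = 0" for i j
    using xs that unfolding weak_nodal_walk_def by auto
  have posy: "f $ (ys ! i) * (\<Prod>l = i..<j. s {ys ! l, ys ! Suc l}) * f $ (ys ! j) > 0"
    if "i < j" "j < length ys" "f $ (ys ! i) \<noteq> 0" "f $ (ys ! j) \<noteq> 0"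
       "\<And>l. i < l \<Longrightarrow> l < j \<Longrightarrow> f $ (ys ! l) = 0" for i j
    using ys that unfolding weak_nodal_walk_def by auto
  have lx: "length xs \<ge> 2" and ly: "length ys \<ge> 2"
    and ex: "\<And>i. Suc i < length xs \<Longrightarrow> {xs ! i, xs ! Suc i} \<in> E"
    and ey: "\<And>i. Suc i < length ys \<Longrightarrow> {ys ! i, ys ! Suc i} \<in> E"
    using xs ys unfolding weak_nodal_walk_def by auto
  define m where "m = length xs - 1"
  have m: "length xs = Suc m" "m \<ge> 1" using lx by (auto simp: m_def)
  have xm: "xs ! m = ys ! 0"
    using join lx ly m by (metis One_nat_def diff_Suc_1 hd_conv_nth last_conv_nth list.size(3) not_numeral_le_zero)
  have zx: "?zs ! i = xs ! i" if "i \<le> m" for i using that m by (simp add: nth_append)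
  have zy: "?zs ! (m + i) = ys ! i" if "i < length ys" for i
  proof (cases i)
    case 0 then show ?thesis using zx[of m] xm by simp
  next
    case (Suc k) then show ?thesis using that m by (simp add: nth_append nth_tl)
  qed
  have zy': "?zs ! i = ys ! (i - m)" if "m \<le> i" "i < m + length ys" for i
    using zy[of "i - m"] that by simp
  have lz: "length ?zs = m + length ys" using m ly by simp
  have zm: "f $ (?zs ! m) \<noteq> 0" using nz zx[of m] xm ly by (metis hd_conv_nth le_refl list.size(3) not_numeral_le_zero)
  have "{?zs ! i, ?zs ! Suc i} \<in> E" if i: "Suc i < length ?zs" for i
  proof (cases "i < m")
    case True then show ?thesis using ex[of i] m zx[of i] zx[of "Suc i"] by simp
  next
    case False
    then have "Suc i - m = Suc (i - m)" by simp
    then show ?thesis using ey[of "i - m"] i lz zy'[of i] zy'[of "Suc i"] False by simp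
  qed
  moreover have "f $ (?zs ! i) * (\<Prod>l = i..<j. s {?zs ! l, ?zs ! Suc l}) * f $ (?zs ! j) > 0"
    if ij: "i < j" "j < length ?zs" and nzij: "f $ (?zs ! i) \<noteq> 0" "f $ (?zs ! j) \<noteq> 0"
      and z: "\<And>l. i < l \<Longrightarrow> l < j \<Longrightarrow> f $ (?zs ! l) = 0" for i j
  proof -
    have "\<not> (i < m \<and> m < j)" using z zm by blast
    then consider "j \<le> m" | "m \<le> i" by linarith
    then show ?thesis
    proof cases
      case 1
      have "(\<Prod>l = i..<j. s {?zs ! l, ?zs ! Suc l}) = (\<Prod>l = i..<j. s {xs ! l, xs ! Suc l})"
        using 1 by (intro prod.cong refl) (metis Suc_leI atLeastLessThan_iff less_imp_le order_trans zx)
      then show ?thesis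
        using posx[of i j] ij nzij z 1 m zx[of i] zx[of j] zx by simp
    next
      case 2
      let ?i = "i - m" and ?j = "j - m"
      have "(\<Prod>l = i..<j. s {?zs ! l, ?zs ! Suc l}) = (\<Prod>l = ?i..<?j. s {ys ! l, ys ! Suc l})"
      proof (rule prod.reindex_bij_witness[of _ "\<lambda>l. l + m" "\<lambda>l. l - m"])
        fix l assume l: "l \<in> {i..<j}"
        then have "Suc l - m = Suc (l - m)" using 2 by (intro Suc_diff_le) simp
        then show "s {ys ! (l - m), ys ! Suc (l - m)} = s {?zs ! l, ?zs ! Suc l}"
          using zy'[of l] zy'[of "Suc l"] l 2 ij lz by simp
      qed (use 2 in auto)
      moreover have "f $ (ys ! ?i) * (\<Prod>l = ?i..<?j. s {ys ! l, ys ! Suc l}) * f $ (ys ! ?j) > 0"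
      proof (rule posy)
        show "f $ (ys ! l) = 0" if "?i < l" "l < ?j" for l
          using z[of "m + l"] zy[of l] that 2 ij lz by simp
      qed (use ij 2 lz nzij zy'[of i] zy'[of j] in auto)
      ultimately show ?thesis using zy'[of i] zy'[of j] 2 ij lz by simp
    qed
  qed
  ultimately show ?thesis using lx unfolding weak_nodal_walk_def by auto
qed

lemma equiv_weak_nodal_rel: "equiv {x. f $ x \<noteq> 0} (weak_nodal_rel E s f)"
proof (rule equivI)
  show "weak_nodal_rel E s f \<subseteq> {x. f $ x \<noteq> 0} \<times> {x. f $ x \<noteq> 0}"
    by (auto simp: weak_nodal_rel_def)
  show "refl_on {x. f $ x \<noteq> 0} (weak_nodal_rel E s f)"
    by (auto simp: weak_nodal_rel_def refl_on_def)
  show "sym (weak_nodal_rel E s f)"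
  proof (rule symI)
    fix x y assume xy: "(x, y) \<in> weak_nodal_rel E s f"
    show "(y, x) \<in> weak_nodal_rel E s f"
    proof (cases "x = y")
      case False
      then obtain xs where "weak_nodal_walk E s f xs" "hd xs = x" "last xs = y"
        using xy by (auto simp: weak_nodal_rel_def)
      then have "weak_nodal_walk E s f (rev xs) \<and> hd (rev xs) = y \<and> last (rev xs) = x"
        using weak_nodal_walk_rev by (simp add: hd_rev last_rev)
      then show ?thesis using xy by (auto simp: weak_nodal_rel_def)
    qed (use xy in simp)
  qed
  show "trans (weak_nodal_rel E s f)"
  proof (rule transI)
    fix x y z assume xy: "(x, y) \<in> weak_nodal_rel E s f" and yz: "(y, z) \<in> weak_nodal_rel E s f"
    show "(x, z) \<in> weak_nodal_rel E s f"
    proof (cases "x = y \<or> y = z")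
      case False
      then obtain xs ys where w: "weak_nodal_walk E s f xs" "hd xs = x" "last xs = y"
          "weak_nodal_walk E s f ys" "hd ys = y" "last ys = z"
        using xy yz by (auto simp: weak_nodal_rel_def)
      have ys: "length ys \<ge> 2" and xs: "length xs \<ge> 2" using w by (auto simp: weak_nodal_walk_def)
      have "weak_nodal_walk E s f (xs @ tl ys)"
        using w xy by (intro weak_nodal_walk_append) (auto simp: weak_nodal_rel_def)
      moreover have "hd (xs @ tl ys) = x" using xs w by (cases xs) auto
      moreover have "last (xs @ tl ys) = z" using ys w by (cases ys) (auto simp: last_append last_tl)
      ultimately show ?thesis using xy yz by (auto simp: weak_nodal_rel_def)
    qed (use xy yz in auto)
  qed
qed

text \<open>
  The initial part of a walk from one nonzero value of \<open>f\<close> to the next. The one-vertex path is included, so that every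
  vertex of the component of the starting point is the end of such a path.
\<close>

definition zero_path :: "'v::finite set set \<Rightarrow> real ^ 'v \<Rightarrow> 'v list \<Rightarrow> bool" where
  "zero_path E f us \<longleftrightarrow> us \<noteq> [] \<and> f $ hd us \<noteq> 0 \<and> (\<forall>i. 0 < i \<and> i < length us \<longrightarrow> f $ (us ! i) = 0) \<and>
     (\<forall>i. Suc i < length us \<longrightarrow> {us ! i, us ! Suc i} \<in> E)"

definition path_sign :: "('v set \<Rightarrow> real) \<Rightarrow> 'v list \<Rightarrow> real" where
  "path_sign s us = (\<Prod>l = 0..<length us - 1. s {us ! l, us ! Suc l})"

lemma zero_path_last_nonzero:
  "zero_path E f us \<Longrightarrow> f $ last us \<noteq> 0 \<Longrightarrow> us = [last us]"
  by (cases us) (auto simp: zero_path_def last_conv_nth split: if_splits)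

lemma zero_path_snoc:
  assumes "zero_path E f us" "{last us, v} \<in> E" "f $ v = 0"
  shows "zero_path E f (us @ [v])"
  unfolding zero_path_def
proof (intro conjI allI impI)
  have us: "us \<noteq> []" using assms by (simp add: zero_path_def)
  show "f $ hd (us @ [v]) \<noteq> 0" using assms us by (simp add: zero_path_def)
  show "f $ ((us @ [v]) ! i) = 0" if "0 < i \<and> i < length (us @ [v])" for i
    using assms that by (auto simp: zero_path_def nth_append)
  show "{(us @ [v]) ! i, (us @ [v]) ! Suc i} \<in> E" if "Suc i < length (us @ [v])" for i
  proof (cases "Suc i < length us")
    case True then show ?thesis using assms by (auto simp: zero_path_def nth_append)
  next
    case False
    then have "i = length us - 1" "i < length us" "Suc i = length us" using that us by auto
    then show ?thesis using assms us by (simp add: nth_append last_conv_nth)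
  qed
qed simp

text \<open>
  In a walk through zeros there is just one pair of consecutive nonzero values: its two ends.
\<close>

lemma weak_nodal_rel_zero_path:
  assumes us: "zero_path E f us" and y: "{last us, y} \<in> E" "f $ y \<noteq> 0"
    and pos: "f $ hd us * path_sign s us * s {last us, y} * f $ y > 0"
  shows "(hd us, y) \<in> weak_nodal_rel E s f"
proof -
  let ?zs = "us @ [y]" and ?n = "length us"
  have ne: "us \<noteq> []" "f $ hd us \<noteq> 0" using us by (auto simp: zero_path_def)
  have n: "?n \<ge> 1" using ne by (cases us) auto
  have edge: "{?zs ! i, ?zs ! Suc i} \<in> E" if "Suc i < length ?zs" for i
  proof (cases "Suc i < length us")
    case True then show ?thesis using us by (auto simp: zero_path_def nth_append)
  next
    case False
    then have "i = length us - 1" "i < length us" "Suc i = length us" using that ne by auto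
    then show ?thesis using y ne by (simp add: nth_append last_conv_nth)
  qed
  have zero: "f $ (?zs ! i) = 0" if "0 < i" "i < ?n" for i
    using us that by (auto simp: zero_path_def nth_append)
  have "(\<Prod>l = 0..<?n. s {?zs ! l, ?zs ! Suc l}) = path_sign s us * s {last us, y}"
  proof -
    obtain k where k: "?n = Suc k" using n by (cases ?n) auto
    have "(\<Prod>l = 0..<k. s {?zs ! l, ?zs ! Suc l}) = path_sign s us"
      unfolding path_sign_def k by (intro prod.cong) (auto simp: nth_append k)
    moreover have "?zs ! k = last us" "?zs ! Suc k = y"
      using k ne by (auto simp: nth_append last_conv_nth)
    ultimately show ?thesis by (simp add: k)
  qed
  moreover have "?zs ! 0 = hd us" "?zs ! ?n = y" using ne by (auto simp: nth_append hd_conv_nth)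
  ultimately have main: "f $ (?zs ! 0) * (\<Prod>l = 0..<?n. s {?zs ! l, ?zs ! Suc l}) * f $ (?zs ! ?n) > 0"
    using pos by (simp add: mult_ac)
  have "weak_nodal_walk E s f ?zs"
    unfolding weak_nodal_walk_def
  proof (intro conjI allI impI)
    show "2 \<le> length ?zs" using n by simp
    fix i j
    assume h: "i < j \<and> j < length ?zs \<and> f $ (?zs ! i) \<noteq> 0 \<and> f $ (?zs ! j) \<noteq> 0 \<and>
       (\<forall>l. i < l \<and> l < j \<longrightarrow> f $ (?zs ! l) = 0)"
    have "i = 0" using zero[of i] h by fastforce
    moreover have "j = ?n" using zero[of j] h by fastforce
    ultimately show "f $ (?zs ! i) * (\<Prod>l = i..<j. s {?zs ! l, ?zs ! Suc l}) * f $ (?zs ! j) > 0"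
      using main by simp
  qed (rule edge)
  moreover have "hd ?zs = hd us" "last ?zs = y" using ne by auto
  ultimately show ?thesis using ne y by (auto simp: weak_nodal_rel_def)
qed

section \<open>Multiples of an eigenfunction and the nodal domain bounds\<close>

text \<open>
  The invariant, propagated along a walk from $x$, is that the current vertex $v$ ends a path of zeros
  whose starting point has the same multiplier as $x$. The one step that matters leaves a zero $v$
  for a nonzero $v'$. Let $T$ be the signed value transported to $v$. Neighbours $y$ of $v$ with $T s_{vy} f(y) > 0$ belong to
  the domain of the starting point. Those with $T s_{vy} f(y) < 0$ all belong to one domain, via $v$. The equation of
  $f$ at $v$ says that both sides have the same total weight, and the equation of $a f$ then says that both sides have the same
  multiplier.
\<close>

lemma multiplier_constant_on_components:
  fixes a :: "'v::finite \<Rightarrow> real" and f :: "real ^ 'v"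
  assumes p: "p > 1"
    and w: "\<And>e. e \<in> E \<Longrightarrow> w e > 0" and s: "\<And>e. e \<in> E \<Longrightarrow> s e \<in> {-1, 1 :: real}"
    and a_rel: "\<And>x y. (x, y) \<in> weak_nodal_rel E s f \<Longrightarrow> a x = a y"
    and a_edge: "\<And>x y. {x, y} \<in> E \<Longrightarrow> f $ x \<noteq> 0 \<Longrightarrow> f $ y \<noteq> 0 \<Longrightarrow> a x = a y"
    and bal_f: "\<And>v. f $ v = 0 \<Longrightarrow> (\<Sum>y | {v, y} \<in> E. w {v, y} * s {v, y} * Phi p (f $ y)) = 0"
    and bal_af: "\<And>v. f $ v = 0 \<Longrightarrow> (\<Sum>y | {v, y} \<in> E. w {v, y} * s {v, y} * Phi p (a y * f $ y)) = 0"
    and conn: "(x, z) \<in> {(x, y). {x, y} \<in> E}\<^sup>*" and x: "f $ x \<noteq> 0" and z: "f $ z \<noteq> 0"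
  shows "a x = a z"
proof -
  have "\<exists>us. zero_path E f us \<and> last us = z \<and> a (hd us) = a x"
    using conn
  proof (induction rule: rtrancl_induct)
    case base
    show ?case using x by (intro exI[of _ "[x]"]) (auto simp: zero_path_def)
  next
    case (step v v')
    then obtain us where us: "zero_path E f us" "last us = v" "a (hd us) = a x" by blast
    have e: "{v, v'} \<in> E" using step by simp
    show ?case
    proof (cases "f $ v' = 0")
      case True
      then show ?thesis
        using zero_path_snoc[OF us(1), of v'] us e
        by (intro exI[of _ "us @ [v']"]) (auto simp: zero_path_def)
    next
      case v': False
      have "a v' = a x"
      proof (cases "f $ v = 0")
        case False
        then have "hd us = v" using zero_path_last_nonzero[OF us(1)] us(2) by (metis list.sel(1))
        then show ?thesis using a_edge[OF e False v'] us(3) by simp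
      next
        case v: True
        let ?N = "{y. {v, y} \<in> E}"
        define T where "T = f $ hd us * path_sign s us"
        define u where "u y = T * s {v, y} * f $ y" for y
        have edges: "Suc l < length us \<Longrightarrow> {us ! l, us ! Suc l} \<in> E" for l
          using us(1) by (simp add: zero_path_def)
        have "s {us ! l, us ! Suc l} \<noteq> 0" if "l \<in> {0..<length us - 1}" for l
        proof -
          have "Suc l < length us" using that by auto
          then show ?thesis using s[OF edges] by fastforce
        qed
        then have "path_sign s us \<noteq> 0" unfolding path_sign_def by simp
        then have T: "T \<noteq> 0" using us(1) by (simp add: T_def zero_path_def)
        have u0: "u y = 0 \<longleftrightarrow> f $ y = 0" if "y \<in> ?N" for y
          using T s[of "{v, y}"] that by (auto simp: u_def)
        have upos: "a y = a x" if y: "y \<in> ?N" "u y > 0" for y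
        proof -
          have "(hd us, y) \<in> weak_nodal_rel E s f"
            using us y u0[OF y(1)] by (intro weak_nodal_rel_zero_path) (auto simp: u_def T_def)
          then show ?thesis using a_rel us(3) by metis
        qed
        have uneg: "a y = a y'" if y: "y \<in> ?N" "u y < 0" and y': "y' \<in> ?N" "u y' < 0" for y y'
        proof -
          have nz: "f $ y \<noteq> 0" "f $ y' \<noteq> 0" using u0[OF y(1)] u0[OF y'(1)] y y' by auto
          have "0 < u y * u y'" using y y' by (simp add: mult_neg_neg)
          also have "u y * u y' = T\<^sup>2 * (f $ y * s {y, v} * s {v, y'} * f $ y')"
            by (simp add: u_def power2_eq_square insert_commute)
          finally have pos: "f $ y * s {y, v} * s {v, y'} * f $ y' > 0"
            by (simp add: zero_less_mult_iff)
          have "{y, v} \<in> E" using y(1) by (simp add: insert_commute)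
          then have "zero_path E f [y, v]" using nz v by (auto simp: zero_path_def less_Suc_eq)
          moreover have "path_sign s [y, v] = s {y, v}" by (simp add: path_sign_def)
          ultimately have "(hd [y, v], y') \<in> weak_nodal_rel E s f"
            using pos nz y' by (intro weak_nodal_rel_zero_path) auto
          then show ?thesis using a_rel by simp
        qed
        show ?thesis
        proof (cases "u v' > 0")
          case True then show ?thesis using upos e by simp
        next
          case False
          then have neg: "u v' < 0" using u0[of v'] e v' by force
          let ?g = "\<lambda>y. w {v, y} * s {v, y} * Phi p (f $ y)"
          let ?Neg = "{y \<in> ?N. u y < 0}"
          have "(\<Sum>y\<in>?N. ?g y * (Phi p (a y) - Phi p (a x))) = 0"
          proof -
            have "(\<Sum>y\<in>?N. ?g y * (Phi p (a y) - Phi p (a x)))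
              = (\<Sum>y\<in>?N. w {v, y} * s {v, y} * Phi p (a y * f $ y)) - Phi p (a x) * (\<Sum>y\<in>?N. ?g y)"
              by (simp add: Phi_mult right_diff_distrib sum_subtractf sum_distrib_left mult_ac)
            then show ?thesis using bal_f[OF v] bal_af[OF v] by simp
          qed
          also have "(\<Sum>y\<in>?N. ?g y * (Phi p (a y) - Phi p (a x)))
            = (\<Sum>y\<in>?Neg. ?g y * (Phi p (a y) - Phi p (a x)))"
          proof (rule sum.mono_neutral_right)
            show "\<forall>y\<in>?N - ?Neg. ?g y * (Phi p (a y) - Phi p (a x)) = 0"
            proof
              fix y assume y: "y \<in> ?N - ?Neg"
              then consider "u y = 0" | "u y > 0" by force
              then show "?g y * (Phi p (a y) - Phi p (a x)) = 0"
                using y u0 upos by cases auto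
            qed
          qed auto
          also have "\<dots> = (\<Sum>y\<in>?Neg. ?g y) * (Phi p (a v') - Phi p (a x))"
            unfolding sum_distrib_right
            using uneg[OF _ _ _ neg] e by (intro sum.cong) auto
          finally have prod0: "(\<Sum>y\<in>?Neg. ?g y) * (Phi p (a v') - Phi p (a x)) = 0" .
          have "T * ?g y < 0" if y: "y \<in> ?Neg" for y
          proof -
            have "f $ y \<noteq> 0" "w {v, y} > 0" using y u0[of y] w by auto
            then have eq: "T * ?g y = (w {v, y} * \<bar>f $ y\<bar> powr (p - 2)) * u y"
              and pos: "w {v, y} * \<bar>f $ y\<bar> powr (p - 2) > 0"
              by (auto simp: Phi_def u_def)
            show ?thesis unfolding eq using pos y by (intro mult_pos_neg) auto
          qed
          moreover have "?Neg \<noteq> {}" using neg e by blast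
          ultimately have "(\<Sum>y\<in>?Neg. T * ?g y) < (\<Sum>y\<in>?Neg. 0)"
            by (intro sum_strict_mono) auto
          then have "T * (\<Sum>y\<in>?Neg. ?g y) < 0" by (simp only: sum_distrib_left sum.neutral_const)
          then have "Phi p (a v') = Phi p (a x)" using prod0 by auto
          then show ?thesis using Phi_inj[OF p] by simp
        qed
      qed
      then show ?thesis using v' by (intro exI[of _ "[v']"]) (auto simp: zero_path_def)
    qed
  qed
  then obtain us where "zero_path E f us" "last us = z" "a (hd us) = a x" by blast
  then show ?thesis using zero_path_last_nonzero[of E f us] z by (metis list.sel(1))
qed

definition multiples :: "('v \<times> 'v) set \<Rightarrow> real ^ 'v \<Rightarrow> (real ^ 'v::finite) set" where
  "multiples r f = {g. \<exists>a. (\<forall>x y. (x, y) \<in> r \<longrightarrow> a x = a y) \<and> g = (\<chi> x. a x * f $ x)}"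

lemma subspace_multiples: "subspace (multiples r f)"
proof (rule subspaceI)
  show "0 \<in> multiples r f"
    unfolding multiples_def by (intro CollectI exI[of _ "\<lambda>x. 0"]) (auto simp: vec_eq_iff)
next
  fix g h assume "g \<in> multiples r f" "h \<in> multiples r f"
  then obtain a b where "\<forall>x y. (x, y) \<in> r \<longrightarrow> a x = a y" "g = (\<chi> x. a x * f $ x)"
    "\<forall>x y. (x, y) \<in> r \<longrightarrow> b x = b y" "h = (\<chi> x. b x * f $ x)" unfolding multiples_def by blast
  then show "g + h \<in> multiples r f"
    unfolding multiples_def by (intro CollectI exI[of _ "\<lambda>x. a x + b x"] conjI)
      (metis, simp add: vec_eq_iff distrib_right)
next
  fix c g assume "g \<in> multiples r f"
  then obtain a where "\<forall>x y. (x, y) \<in> r \<longrightarrow> a x = a y" "g = (\<chi> x. a x * f $ x)"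
    unfolding multiples_def by blast
  then show "c *\<^sub>R g \<in> multiples r f"
    unfolding multiples_def by (intro CollectI exI[of _ "\<lambda>x. c * a x"] conjI)
      (metis, simp add: vec_eq_iff)
qed

definition restriction :: "real ^ 'v \<Rightarrow> 'v set \<Rightarrow> real ^ 'v::finite" where
  "restriction f D = (\<chi> x. if x \<in> D then f $ x else 0)"

text \<open>
  The restrictions of \<open>f\<close> to the classes have disjoint supports, so they are orthogonal, hence independent.
\<close>

lemma card_classes_le_dim_multiples:
  assumes eq: "equiv {x. f $ x \<noteq> 0} r"
  shows "card ({x. f $ x \<noteq> 0} // r) \<le> dim (multiples r f)"
proof -
  let ?\<Omega> = "{x. f $ x \<noteq> 0}" let ?Q = "?\<Omega> // r" let ?B = "restriction f ` ?Q"
  have sub: "C \<subseteq> ?\<Omega>" if "C \<in> ?Q" for C using in_quotient_imp_subset[OF eq that] .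
  have supp: "{x. restriction f C $ x \<noteq> 0} = C" if "C \<in> ?Q" for C
    using sub[OF that] by (auto simp: restriction_def)
  have inj: "inj_on (restriction f) ?Q" by (rule inj_onI) (metis supp)
  have "0 \<notin> ?B"
  proof
    assume "0 \<in> ?B"
    then obtain C where "C \<in> ?Q" "restriction f C = 0" by auto
    then show False using supp[of C] in_quotient_imp_non_empty[OF eq, of C] by auto
  qed
  moreover have "pairwise orthogonal ?B"
  proof (rule pairwiseI)
    fix g h assume g: "g \<in> ?B" "h \<in> ?B" "g \<noteq> h"
    then obtain C D where CD: "C \<in> ?Q" "D \<in> ?Q" "g = restriction f C" "h = restriction f D" by auto
    then have "C \<inter> D = {}" using quotient_disj[OF eq CD(1,2)] g(3) by auto
    then have "g $ x * h $ x = 0" for x using CD by (auto simp: restriction_def)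
    then show "orthogonal g h" by (auto simp: orthogonal_def inner_vec_def intro!: sum.neutral)
  qed
  ultimately have ind: "independent ?B" by (intro pairwise_orthogonal_independent)
  have "?B \<subseteq> multiples r f"
  proof
    fix g assume "g \<in> ?B"
    then obtain C where C: "C \<in> ?Q" "g = restriction f C" by auto
    have "x \<in> C \<longleftrightarrow> y \<in> C" if "(x, y) \<in> r" for x y
      using in_quotient_imp_closed[OF eq C(1)] that equivE[OF eq] by (meson symD)
    then show "g \<in> multiples r f"
      unfolding multiples_def C(2) restriction_def
      by (intro CollectI exI[of _ "\<lambda>x. if x \<in> C then 1 else 0"]) (auto simp: vec_eq_iff)
  qed
  then have "card ?B \<le> dim (multiples r f)" using ind by (rule independent_card_le_dim)
  then show ?thesis using inj by (simp add: card_image)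
qed

lemma dim_le_dim_Int_orthogonal:
  fixes X :: "'a::euclidean_space set"
  assumes X: "subspace X" and F: "finite F"
  shows "subspace {y \<in> X. \<forall>x\<in>F. orthogonal x y}"
    and "dim X \<le> dim {y \<in> X. \<forall>x\<in>F. orthogonal x y} + card F"
proof -
  let ?O = "{y. \<forall>x\<in>F. orthogonal x y}"
  have O: "subspace ?O" by (auto intro!: subspaceI simp: orthogonal_clauses)
  have I: "{y \<in> X. \<forall>x\<in>F. orthogonal x y} = X \<inter> ?O" by auto
  show "subspace {y \<in> X. \<forall>x\<in>F. orthogonal x y}" unfolding I using X O by (rule subspace_inter)
  have "(\<forall>x\<in>F. orthogonal x y) \<longleftrightarrow> (\<forall>x\<in>span F. orthogonal x y)" for y
    using orthogonal_to_span[of _ F y] span_base[of _ F] by (metis orthogonal_commute)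
  then have "?O = {y \<in> UNIV. \<forall>x\<in>span F. orthogonal x y}" by simp
  moreover have "dim {y \<in> UNIV. \<forall>x\<in>span F. orthogonal x y} + dim (span F) = dim (UNIV :: 'a set)"
    by (rule dim_subspace_orthogonal_to_vectors) auto
  ultimately have "dim ?O + dim F = DIM('a)" by simp
  moreover have "dim F \<le> card F" using F by (rule dim_le_card'[OF finite_subset[OF subset_refl]])
  moreover have "dim {x + y |x y. x \<in> X \<and> y \<in> ?O} + dim (X \<inter> ?O) = dim X + dim ?O"
    using X O by (rule dim_sums_Int)
  moreover have "dim {x + y |x y. x \<in> X \<and> y \<in> ?O} \<le> DIM('a)" by (rule dim_subset_UNIV)
  ultimately show "dim X \<le> dim {y \<in> X. \<forall>x\<in>F. orthogonal x y} + card F" unfolding I by linarith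
qed

context signed_graph
begin

text \<open>
  This is \<open>grad_inner\<close> with $h = |a|^p f$, subtracted from the energy: the potential and the mass terms cancel.
\<close>

lemma energy_multiple:
  assumes f: "eigenfunction E w \<mu> \<kappa> \<sigma> p l f"
  shows "energy l (\<chi> x. a x * f $ x) = (\<Sum>x\<in>UNIV. \<Sum>y | {x, y} \<in> E. w {x, y} *
     (\<bar>a x * f $ x - a y * (\<sigma> {x, y} * f $ y)\<bar> powr p
      - Phi p (f $ x - \<sigma> {x, y} * f $ y) * (\<bar>a x\<bar> powr p * f $ x - \<bar>a y\<bar> powr p * (\<sigma> {x, y} * f $ y)))) / 2"
proof -
  have "grad l f = 0" using f by (simp add: eigenfunction_def grad_def vec_eq_iff)
  then have 0: "(\<Sum>x\<in>UNIV. (\<bar>a x\<bar> powr p * f $ x) * grad l f $ x) = 0" by simp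
  have v: "Phi p (f $ x) * (\<bar>a x\<bar> powr p * f $ x) = \<bar>a x * f $ x\<bar> powr p" for x
    by (simp add: abs_mult powr_mult Phi_self[symmetric] mult_ac)
  have e: "a x * f $ x - \<sigma> {x, y} * (a y * f $ y) = a x * f $ x - a y * (\<sigma> {x, y} * f $ y)"
    "\<bar>a x\<bar> powr p * f $ x - \<sigma> {x, y} * (\<bar>a y\<bar> powr p * f $ y) = \<bar>a x\<bar> powr p * f $ x - \<bar>a y\<bar> powr p * (\<sigma> {x, y} * f $ y)" for x y
    by (simp_all add: mult_ac)
  show ?thesis
    using 0 unfolding grad_inner v
    by (simp add: energy_def mass_def e right_diff_distrib sum_subtractf diff_divide_distrib)
qed

text \<open>
  The test space for both bounds, with $\tau = 1$ for the signature $\sigma$ and $\tau = -1$ for $-\sigma$. A multiple $a f$ with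
  $a$ constant on components is determined by its inner products with the restrictions of $f$ to the components, so
  requiring these to vanish costs at most one dimension per component and removes all nonzero critical points of zero energy.
\<close>

lemma regular_subspace_of_multiples:
  assumes f: "eigenfunction E w \<mu> \<kappa> \<sigma> p l f" and \<tau>: "\<tau> \<in> {-1, 1 :: real}"
    and s: "s = (\<lambda>e. \<tau> * \<sigma> e)"
  obtains X where "subspace X"
    "num_weak_nodal_domains E s f \<le> dim X + num_components E"
    "\<And>g. g \<in> X \<Longrightarrow> \<tau> * energy l g \<le> 0"
    "\<And>g. g \<in> X \<Longrightarrow> g \<noteq> 0 \<Longrightarrow> energy l g = 0 \<Longrightarrow> grad l g \<noteq> 0"
proof -
  let ?r = "weak_nodal_rel E s f"
  let ?R = "{(x, y). {x, y} \<in> E}\<^sup>*"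
  let ?D = "UNIV // ?R"
  let ?F = "restriction f ` ?D"
  let ?M = "multiples ?r f"
  let ?X = "{y \<in> ?M. \<forall>x\<in>?F. orthogonal x y}"
  have s_pm: "s e \<in> {-1, 1}" if "e \<in> E" for e using \<tau> sigma[OF that] by (auto simp: s)
  have eqR: "equiv UNIV ?R"
  proof (rule equivI)
    have "sym {(x, y). {x, y} \<in> E}" by (auto intro: symI simp: insert_commute)
    then show "sym ?R" by (rule sym_rtrancl)
  qed (auto intro: refl_onI trans_rtrancl)
  have edge_sign: "\<tau> * B \<le> 0 \<and> (B = 0 \<longrightarrow> f $ x \<noteq> 0 \<longrightarrow> f $ y \<noteq> 0 \<longrightarrow> a x = a y)"
    if e: "{x, y} \<in> E" and a: "\<forall>x y. (x, y) \<in> ?r \<longrightarrow> a x = a y"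
      and B: "B = \<bar>a x * f $ x - a y * (\<sigma> {x, y} * f $ y)\<bar> powr p
      - Phi p (f $ x - \<sigma> {x, y} * f $ y) * (\<bar>a x\<bar> powr p * f $ x - \<bar>a y\<bar> powr p * (\<sigma> {x, y} * f $ y))"
    for a x y B
  proof -
    let ?u = "f $ x" and ?v = "\<sigma> {x, y} * f $ y"
    have \<sigma>: "\<sigma> {x, y} \<noteq> 0" using sigma[OF e] by auto
    consider "?u = 0" | "?v = 0" | "a x = a y" | "?u \<noteq> 0" "?v \<noteq> 0" "a x \<noteq> a y" by blast
    then show ?thesis
    proof cases
      case 1
      have "B = \<bar>a y * ?v\<bar> powr p - Phi p ?v * (\<bar>a y\<bar> powr p * ?v)"
        unfolding B 1 by simp
      also have "Phi p ?v * (\<bar>a y\<bar> powr p * ?v) = \<bar>a y * ?v\<bar> powr p"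
        using Phi_self[of p ?v] by (simp add: abs_mult powr_mult mult_ac)
      finally show ?thesis using 1 by simp
    next
      case 2
      have "B = \<bar>a x * ?u\<bar> powr p - Phi p ?u * (\<bar>a x\<bar> powr p * ?u)"
        unfolding B 2 by simp
      also have "Phi p ?u * (\<bar>a x\<bar> powr p * ?u) = \<bar>a x * ?u\<bar> powr p"
        using Phi_self[of p ?u] by (simp add: abs_mult powr_mult mult_ac)
      finally show ?thesis using 2 \<sigma> by simp
    next
      case 3
      have "B = \<bar>a y * (?u - ?v)\<bar> powr p - Phi p (?u - ?v) * (\<bar>a y\<bar> powr p * (?u - ?v))"
        unfolding B 3 by (simp add: right_diff_distrib)
      also have "Phi p (?u - ?v) * (\<bar>a y\<bar> powr p * (?u - ?v)) = \<bar>a y * (?u - ?v)\<bar> powr p"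
        using Phi_self[of p "?u - ?v"] by (simp add: abs_mult powr_mult mult_ac)
      finally show ?thesis using 3 by simp
    next
      case 4
      then have fx: "f $ x \<noteq> 0" and fy: "f $ y \<noteq> 0" by auto
      have "\<not> f $ x * s {x, y} * f $ y > 0"
      proof
        assume "f $ x * s {x, y} * f $ y > 0"
        then have "(hd [x], y) \<in> ?r"
          using e fx fy by (intro weak_nodal_rel_zero_path) (auto simp: zero_path_def path_sign_def)
        then show False using a 4(3) by auto
      qed
      then have neg: "\<tau> * (?u * ?v) < 0" using fx fy \<sigma> \<tau> by (auto simp: s mult_ac not_less less_le)
      have "\<tau> * B < 0"
      proof (cases "\<tau> = 1")
        case True
        then show ?thesis using edge_term_opposite_signs[OF p_gt_1, of ?u ?v "a x" "a y"] neg 4(3) by (simp add: B)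
      next
        case False
        then have "\<tau> = -1" using \<tau> by simp
        then show ?thesis using edge_term_same_sign[OF p_gt_1, of ?u ?v "a x" "a y"] neg 4(3) by (simp add: B)
      qed
      then show ?thesis by auto
    qed
  qed
  have sign: "\<tau> * energy l g \<le> 0" and crit: "energy l g = 0 \<Longrightarrow> {x, y} \<in> E \<Longrightarrow> f $ x \<noteq> 0 \<Longrightarrow> f $ y \<noteq> 0 \<Longrightarrow> a x = a y"
    if a: "\<forall>x y. (x, y) \<in> ?r \<longrightarrow> a x = a y" and g: "g = (\<chi> x. a x * f $ x)" for g a x y
  proof -
    define B where "B x y = \<bar>a x * f $ x - a y * (\<sigma> {x, y} * f $ y)\<bar> powr p
      - Phi p (f $ x - \<sigma> {x, y} * f $ y) * (\<bar>a x\<bar> powr p * f $ x - \<bar>a y\<bar> powr p * (\<sigma> {x, y} * f $ y))" for x y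
    have tB: "\<tau> * B x y \<le> 0 \<and> (B x y = 0 \<longrightarrow> f $ x \<noteq> 0 \<longrightarrow> f $ y \<noteq> 0 \<longrightarrow> a x = a y)" if "{x, y} \<in> E" for x y
      using edge_sign[OF that a B_def] .
    have e: "\<tau> * energy l g = - (\<Sum>x\<in>UNIV. \<Sum>y | {x, y} \<in> E. w {x, y} * - (\<tau> * B x y)) / 2"
      unfolding g energy_multiple[OF f] B_def[symmetric]
      by (simp add: sum_negf sum_distrib_left mult_ac)
    have nn: "w {x, y} * - (\<tau> * B x y) \<ge> 0" if "{x, y} \<in> E" for x y
      using tB[OF that] w_pos[OF that] by (intro mult_nonneg_nonneg) auto
    then have nn': "(\<Sum>y | {x, y} \<in> E. w {x, y} * - (\<tau> * B x y)) \<ge> 0" for x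
      by (intro sum_nonneg) simp
    then show "\<tau> * energy l g \<le> 0" unfolding e by (simp add: sum_nonneg)
    assume 0: "energy l g = 0" and xy: "{x, y} \<in> E" "f $ x \<noteq> 0" "f $ y \<noteq> 0"
    have "(\<Sum>x\<in>UNIV. \<Sum>y | {x, y} \<in> E. w {x, y} * - (\<tau> * B x y)) = 0" using e 0 by simp
    then have "(\<Sum>y | {x, y} \<in> E. w {x, y} * - (\<tau> * B x y)) = 0"
      using nn' by (subst (asm) sum_nonneg_eq_0_iff) auto
    then have "w {x, y} * - (\<tau> * B x y) = 0"
      using nn xy by (subst (asm) sum_nonneg_eq_0_iff) auto
    then have "B x y = 0" using w_pos[OF xy(1)] \<tau> by auto
    then show "a x = a y" using tB[OF xy(1)] xy by simp
  qed
  have balance: "(\<Sum>y | {v, y} \<in> E. w {v, y} * s {v, y} * Phi p (h $ y)) = 0"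
    if h: "grad l h = 0" "h $ v = 0" for h v
  proof -
    have P: "Phi p (- (\<sigma> {v, y} * h $ y)) = - (\<sigma> {v, y} * Phi p (h $ y))" if "{v, y} \<in> E" for y
    proof -
      have "Phi p (\<sigma> {v, y}) = \<sigma> {v, y}" using sigma[OF that] by auto
      then show ?thesis by (simp add: Phi_mult)
    qed
    have "0 = grad l h $ v" using h by simp
    also have "\<dots> = (\<Sum>y | {v, y} \<in> E. w {v, y} * - (\<sigma> {v, y} * Phi p (h $ y)))"
      unfolding grad_def p_laplacian_def using h P by (simp del: Phi_minus)
    finally have "(\<Sum>y | {v, y} \<in> E. w {v, y} * (\<sigma> {v, y} * Phi p (h $ y))) = 0"
      by (simp add: sum_negf)
    then have "\<tau> * (\<Sum>y | {v, y} \<in> E. w {v, y} * (\<sigma> {v, y} * Phi p (h $ y))) = 0" by simp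
    then show ?thesis by (simp add: s sum_distrib_left mult_ac)
  qed
  have gradf: "grad l f = 0" using f by (simp add: eigenfunction_def grad_def vec_eq_iff)
  have fin: "finite ?F" by simp
  show thesis
  proof (rule that[of ?X])
    show "subspace ?X" by (rule dim_le_dim_Int_orthogonal(1)[OF subspace_multiples fin])
    have "card ?F \<le> num_components E" unfolding num_components_def by (rule card_image_le) simp
    moreover have "num_weak_nodal_domains E s f \<le> dim ?M"
      unfolding num_weak_nodal_domains_def by (rule card_classes_le_dim_multiples[OF equiv_weak_nodal_rel])
    ultimately show "num_weak_nodal_domains E s f \<le> dim ?X + num_components E"
      using dim_le_dim_Int_orthogonal(2)[OF subspace_multiples fin, of ?r f] by linarith
    show "\<tau> * energy l g \<le> 0" if "g \<in> ?X" for g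
      using that sign unfolding multiples_def by blast
    show "grad l g \<noteq> 0" if g: "g \<in> ?X" "g \<noteq> 0" "energy l g = 0" for g
    proof
      assume gg: "grad l g = 0"
      obtain a where a: "\<forall>x y. (x, y) \<in> ?r \<longrightarrow> a x = a y" "g = (\<chi> x. a x * f $ x)"
        using g(1) unfolding multiples_def by blast
      have const: "a x = a z" if "(x, z) \<in> ?R" "f $ x \<noteq> 0" "f $ z \<noteq> 0" for x z
      proof (rule multiplier_constant_on_components[OF p_gt_1 w_pos s_pm _ _ _ _ that])
        show "(\<Sum>y | {v, y} \<in> E. w {v, y} * s {v, y} * Phi p (a y * f $ y)) = 0" if "f $ v = 0" for v
          using balance[OF gg, of v] that a(2) by simp
      qed (use a(1) crit[OF a g(3)] balance[OF gradf] in auto)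
      have "g $ x = 0" for x
      proof (cases "f $ x = 0")
        case True then show ?thesis by (simp add: a(2))
      next
        case False
        let ?C = "?R `` {x}"
        have C: "?C \<in> ?D" by (simp add: quotientI)
        then have "restriction f ?C \<bullet> g = 0" using g(1) by (auto simp: orthogonal_def)
        moreover have "restriction f ?C \<bullet> g = (\<Sum>y\<in>UNIV. a x * (restriction f ?C $ y)\<^sup>2)"
          unfolding inner_vec_def
        proof (intro sum.cong refl)
          fix y show "restriction f ?C $ y \<bullet> g $ y = a x * (restriction f ?C $ y)\<^sup>2"
            using const[of x y] False by (cases "f $ y = 0") (auto simp: restriction_def a(2) power2_eq_square)
        qed
        ultimately have "a x * (\<Sum>y\<in>UNIV. (restriction f ?C $ y)\<^sup>2) = 0" by (simp add: sum_distrib_left)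
        moreover have "(\<Sum>y\<in>UNIV. (restriction f ?C $ y)\<^sup>2) \<noteq> 0"
        proof
          assume "(\<Sum>y\<in>UNIV. (restriction f ?C $ y)\<^sup>2) = 0"
          then have "restriction f ?C $ x = 0" by (simp add: sum_nonneg_eq_0_iff)
          then show False using False by (simp add: restriction_def)
        qed
        ultimately show ?thesis by (simp add: a(2))
      qed
      then show False using g(2) by (simp add: vec_eq_iff)
    qed
  qed
qed

end

theorem theorem3:
  fixes E :: "'v::finite set set"
    and w \<sigma> :: "'v set \<Rightarrow> real"
    and \<mu> \<kappa> :: "'v \<Rightarrow> real"
    and p :: real
    and k r :: nat
    and f :: "real ^ 'v"
  defines "n \<equiv> CARD('v)"
    and "c \<equiv> num_components E"
    and "ev \<equiv> variational_eigenvalue E w \<mu> \<kappa> \<sigma> p"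
  assumes "simple_edges E"
    and "\<forall>e\<in>E. w e > 0"
    and "\<forall>e\<in>E. \<sigma> e \<in> {-1, 1}"
    and "\<forall>x. \<mu> x > 0"
    and "p > 1"
    and "k \<ge> 1" and "r \<ge> 1" and "k + r - 1 \<le> n"
    and "k > 1 \<longrightarrow> ev (k - 1) < ev k"
    and "\<forall>i\<in>{k..k + r - 1}. ev i = ev k"
    and "k + r - 1 < n \<longrightarrow> ev (k + r - 1) < ev (k + r)"
    and "eigenfunction E w \<mu> \<kappa> \<sigma> p (ev k) f"
  shows "int (num_weak_nodal_domains E \<sigma> f) \<le> int k + int c - 1 \<and>
         int (num_weak_nodal_domains E (\<lambda>e. - \<sigma> e) f) \<le> int n - int k - int r + int c + 1"
proof -
  interpret signed_graph E w \<sigma> \<mu> \<kappa> p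
    using assms(5-8) by unfold_locales auto
  have eig: "eigenfunction E w \<mu> \<kappa> \<sigma> p (ev k) f" by fact
  \<comment> \<open>Domains of $(G,\<sigma>)$: the energy is nonpositive on the test space, which forces its dimension below $k$.\<close>
  obtain X where X: "subspace X" "num_weak_nodal_domains E \<sigma> f \<le> dim X + c"
      "\<And>g. g \<in> X \<Longrightarrow> energy (ev k) g \<le> 0"
      "\<And>g. g \<in> X \<Longrightarrow> g \<noteq> 0 \<Longrightarrow> energy (ev k) g = 0 \<Longrightarrow> grad (ev k) g \<noteq> 0"
  proof (rule regular_subspace_of_multiples[OF eig, of 1 \<sigma>])
    fix X assume "subspace X" "num_weak_nodal_domains E \<sigma> f \<le> dim X + num_components E"
      "\<And>g. g \<in> X \<Longrightarrow> 1 * energy (ev k) g \<le> 0"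
      "\<And>g. g \<in> X \<Longrightarrow> g \<noteq> 0 \<Longrightarrow> energy (ev k) g = 0 \<Longrightarrow> grad (ev k) g \<noteq> 0"
    then show thesis by (intro that[of X]) (simp_all add: c_def)
  qed simp_all
  have "dim X < k"
  proof (rule ccontr)
    assume "\<not> dim X < k"
    then have "k \<le> dim X" by simp
    from eigval_less_if_nonpositive_on_subspace[OF X(1) \<open>k \<ge> 1\<close> this X(3,4)]
    show False by (simp add: ev_def)
  qed
  \<comment> \<open>Domains of $(G,-\<sigma>)$: the energy is nonnegative, and the comparison is with the last index of the group of equal eigenvalues.\<close>
  obtain Y where Y: "subspace Y" "num_weak_nodal_domains E (\<lambda>e. - \<sigma> e) f \<le> dim Y + c"
      "\<And>g. g \<in> Y \<Longrightarrow> energy (ev k) g \<ge> 0"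
      "\<And>g. g \<in> Y \<Longrightarrow> g \<noteq> 0 \<Longrightarrow> energy (ev k) g = 0 \<Longrightarrow> grad (ev k) g \<noteq> 0"
  proof (rule regular_subspace_of_multiples[OF eig, of "-1" "\<lambda>e. - \<sigma> e"])
    fix Y assume "subspace Y" "num_weak_nodal_domains E (\<lambda>e. - \<sigma> e) f \<le> dim Y + num_components E"
      "\<And>g. g \<in> Y \<Longrightarrow> - 1 * energy (ev k) g \<le> 0"
      "\<And>g. g \<in> Y \<Longrightarrow> g \<noteq> 0 \<Longrightarrow> energy (ev k) g = 0 \<Longrightarrow> grad (ev k) g \<noteq> 0"
    then show thesis by (intro that[of Y]) (simp_all add: c_def)
  qed simp_all
  define K where "K = k + r - 1"
  have K: "1 \<le> K" "K \<le> n" using assms(9-11) by (simp_all add: K_def)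
  have "K \<in> {k..k + r - 1}" using assms(9,10) by (simp add: K_def)
  then have evK: "ev K = ev k" using assms(13) by blast
  have "K + dim Y \<le> n"
  proof (rule ccontr)
    assume "\<not> K + dim Y \<le> n"
    then have "CARD('v) < K + dim Y" by (simp add: n_def)
    from eigval_greater_if_nonnegative_on_subspace[OF Y(1) K(1) K(2)[unfolded n_def] this Y(3,4)]
    show False using evK by (simp add: ev_def)
  qed
  then show ?thesis using X(2) Y(2) \<open>dim X < k\<close> assms(9,10) by (simp add: K_def)
qed

end
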